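(* Under the assumptions and notation of the context, and under the null hypothesis $\upsilon_\perp^{\mathsf T}R_IL_I^{\mathsf T}=0$, where $\upsilon_\perp\in\mathbb R^{p\times m}$ is a matrix chosen by the researcher, the Wald statistic $$\hat W_n(\upsilon_\perp)=T\,\operatorname{vec}\left(\upsilon_\perp^{\mathsf T}\hat R_I\hat L_I^{\mathsf T}\right)^{\mathsf T}\hat\Omega_W^{+}\operatorname{vec}\left(\upsilon_\perp^{\mathsf T}\hat R_I\hat L_I^{\mathsf T}\right)$$ converges in distribution to a $\chi^2_{qm}$ random variable as the sample size $T\to\infty$. Here $\hat\Omega_W=\hat B\hat\Omega\hat B^{\mathsf T}$, $\hat\Omega_W^+$ is a generalized inverse of $\hat\Omega_W$, and $\hat B$ is the sample analogue of $$B=\left(L_I\otimes\upsilon_\perp^{\mathsf T}R_J\right)\left\{\left(\Lambda_I^{\mathsf T}\otimes I_{p-q}\right)-\left(I_q\otimes\Lambda_J\right)\right\}^{-1}\left(R_I^{\mathsf T}\otimes L_J^{\mathsf T}\right).$$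
   Context: Matrices considered. $M\in\mathbb R^{p\times p}$ is such that there is a nonsingular matrix $R=[R_I\ R_J]\in\mathbb R^{p\times p}$, $R_I\in\mathbb R^{p\times q}$, $R_J\in\mathbb R^{p\times(p-q)}$, with $L=[L_I\ L_J]=R^{-\mathsf T}$ partitioned conformably and $$R^{-1}MR=\begin{bmatrix}\Lambda_I&\Lambda_{IJ}\\0&\Lambda_J\end{bmatrix},\qquad \Lambda_I\in\mathbb R^{q\times q},\ \Lambda_J\in\mathbb R^{(p-q)\times(p-q)}.$$ The sets of eigenvalues $\mathcal L_I$ of $\Lambda_I$ and $\mathcal L_J$ of $\Lambda_J$ are disjoint, $\mathcal L_I$ is closed under complex conjugation, and $|\lambda_q|>|\lambda_{q+1}|$, where the eigenvalues of $M$ are numbered $\lambda_1,\dots,\lambda_p$ by decreasing modulus, those in $\mathcal L_I$ first. There is a full-rank normalizing matrix $G\in\mathbb R^{p\times q}$ with $\operatorname{rank}G^{\mathsf T}R_I=q$. $M$ need not be diagonalizable. Choice of $\upsilon_\perp$. To test whether hypothesised vectors $\upsilon$ lie in the span of the columns of $R_I$, $\upsilon_\perp$ is constructed as an orthocomplement, $\upsilon_\perp^{\mathsf T}\upsilon=0$. Its column dimension $m$ is chosen by the researcher; normally $m=p-q$ for a hypothesised eigenspace of dimension $q$, although further columns could be added so that $m$ could exceed $p-q$. Data. (i) If $p=n$ is growing, the estimator $\hat M$ is $1/r_n$-consistent: $\|\hat M_n-M_n\|_F=O_p(r_n)$ in the Frobenius norm. (ii) The model $M_t=M+\varepsilon_t$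 generates data $\{M_t\}_{t=1}^T$, with identically distributed mean-zero errors $\varepsilon_t$ whose vectorizations have a general positive-definite covariance matrix $\Omega\in\mathbb R^{p^2\times p^2}$; for $M$ of fixed size, the estimator $\hat M_T=T^{-1}\sum_{t=1}^TM_t$ satisfies that $\sqrt T\operatorname{vec}(\hat M_T-M)$ converges in distribution to $N(0,\Omega)$. (iii) $\hat\Omega$ is a consistent estimator of $\Omega$, i.e. $\hat\Omega\to\Omega$ in probability. Hatted quantities $\hat R_I,\hat R_J,\hat L_I,\hat L_J,\hat\Lambda_I,\hat\Lambda_J$ are the sample analogues, i.e. the corresponding quantities for $\hat M_T$; $\hat B$ is $B$ with these inserted. A generalized inverse of a matrix $A$ of rank $s$ is $A^+$ with $AA^+A=A$, given either by $A^+=\sum_{i=1}^s\lambda_i^{-1}P_{\lambda_i}$, with $\lambda_i$ the nonzero eigenvalues and $P_{\lambda_i}$ the associated rank-one eigenprojections (right times left eigenvector), when $A$ is diagonalizable, or by $A^+=\sum_{i=1}^s\iota_i^{-1}v_iu_i^{\mathsf T}$, with $\iota_i$ the nonzero singular values and $u_i,v_i$ the left and right singular vectors.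
   Formalization: Two hypotheses added: υ⊥ has full column rank m (so m ≤ p−q; otherwise, e.g. υ⊥=0, the limit is not χ²_{qm}), and R̂_I Λ̂_IJ L̂_J^T is bounded in probability (a freely moving sample complement R̂_J breaks the limit). *)

theory Defs
  imports "HOL-Probability.Probability"
begin

section \<open>Matrices\<close>

text \<open>A matrix in \<open>real^'n^'m\<close> has \<open>m\<close> rows and \<open>n\<close> columns. Entries of \<open>vec_mat X\<close> are indexed by
  (column, row), so that with the column-major (lexicographic) order on pairs this is the usual
  column-stacking operator, and \<open>vec_mat (A ** X ** B) = kron (transpose B) A *v vec_mat X\<close>.\<close>

definition vec_mat :: "'a^'n^'m \<Rightarrow> 'a^('n \<times> 'm)" where
  "vec_mat X = (\<chi> k. X $ snd k $ fst k)"

definition kron :: "'a::times^'b^'c \<Rightarrow> 'a^'d^'e \<Rightarrow> 'a^('b \<times> 'd)^('c \<times> 'e)" where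
  "kron A B = (\<chi> i j. A $ fst i $ fst j * B $ snd i $ snd j)"

definition spectrum :: "real^'n^'n \<Rightarrow> complex set" where
  "spectrum A = {z. \<exists>v. v \<noteq> 0 \<and> map_matrix complex_of_real A *v v = z *s v}"

definition pos_def :: "real^'n^'n \<Rightarrow> bool" where
  "pos_def A \<longleftrightarrow> transpose A = A \<and> (\<forall>x. x \<noteq> 0 \<longrightarrow> 0 < x \<bullet> (A *v x))"

definition outer :: "'a::times^'m \<Rightarrow> 'a^'n \<Rightarrow> 'a^'n^'m" where
  "outer u v = (\<chi> i j. u $ i * v $ j)"

text \<open>The columns of \<open>S\<close> are right eigenvectors of \<open>A\<close>, the rows of \<open>matrix_inv S\<close> the left ones.
  Diagonalisability is over the complex numbers, since \<open>A\<close> is not required to be symmetric.\<close>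

definition spectral_ginv :: "real^'n^'n \<Rightarrow> real^'n^'n \<Rightarrow> bool" where
  "spectral_ginv A X \<longleftrightarrow>
     (\<exists>(S :: complex^'n^'n) (d :: 'n \<Rightarrow> complex). invertible S \<and>
        (\<forall>i. map_matrix of_real A *v column i S = d i *s column i S) \<and>
        map_matrix of_real X =
          (\<Sum>i\<in>{i. d i \<noteq> 0}. map_matrix ((*) (inverse (d i))) (outer (column i S) (row i (matrix_inv S)))))"

definition svd_ginv :: "real^'n^'n \<Rightarrow> real^'n^'n \<Rightarrow> bool" where
  "svd_ginv A X \<longleftrightarrow>
     (\<exists>(\<iota> :: nat \<Rightarrow> real) (u :: nat \<Rightarrow> real^'n) (v :: nat \<Rightarrow> real^'n).
        (\<forall>i<rank A. 0 < \<iota> i) \<and>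
        (\<forall>i<rank A. \<forall>j<rank A. u i \<bullet> u j = (if i = j then 1 else 0)) \<and>
        (\<forall>i<rank A. \<forall>j<rank A. v i \<bullet> v j = (if i = j then 1 else 0)) \<and>
        A = (\<Sum>i<rank A. \<iota> i *\<^sub>R outer (u i) (v i)) \<and>
        X = (\<Sum>i<rank A. inverse (\<iota> i) *\<^sub>R outer (v i) (u i)))"

definition generalized_inverse :: "real^'n^'n \<Rightarrow> real^'n^'n \<Rightarrow> bool" where
  "generalized_inverse A X \<longleftrightarrow> A ** X ** A = A \<and> (spectral_ginv A X \<or> svd_ginv A X)"


section \<open>Block-triangular spectral decompositions\<close>

text \<open>The columns of \<open>R\<close> are indexed by a sum type: \<open>Inl\<close> selects the \<open>q\<close> columns of the block \<open>I\<close>,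
  \<open>Inr\<close> the remaining \<open>p - q\<close> columns of the block \<open>J\<close>. The library notions \<open>invertible\<close> and
  \<open>matrix_inv\<close> are the two-sided ones and allow different row and column index types;
  \<open>invertible R\<close> forces \<open>p = q + (p - q)\<close> and \<open>matrix_inv R\<close> is the inverse of \<open>R\<close>.\<close>

definition block_I :: "'a^('q::finite + 'j::finite)^'p \<Rightarrow> 'a^'q^'p" where
  "block_I R = (\<chi> i k. R $ i $ Inl k)"

definition block_J :: "'a^('q::finite + 'j::finite)^'p \<Rightarrow> 'a^'j^'p" where
  "block_J R = (\<chi> i k. R $ i $ Inr k)"

definition left_basis :: "real^('q::finite + 'j::finite)^'p \<Rightarrow> real^('q + 'j)^'p" where
  "left_basis R = transpose (matrix_inv R)"

definition similar_mat :: "real^'p^'p \<Rightarrow> real^('q::finite + 'j::finite)^'p \<Rightarrow> real^('q + 'j)^('q + 'j)" where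
  "similar_mat M R = matrix_inv R ** M ** R"

definition Lam_I :: "real^'p^'p \<Rightarrow> real^('q::finite + 'j::finite)^'p \<Rightarrow> real^'q^'q" where
  "Lam_I M R = (\<chi> i k. similar_mat M R $ Inl i $ Inl k)"

definition Lam_IJ :: "real^'p^'p \<Rightarrow> real^('q::finite + 'j::finite)^'p \<Rightarrow> real^'j^'q" where
  "Lam_IJ M R = (\<chi> i k. similar_mat M R $ Inl i $ Inr k)"

definition Lam_J :: "real^'p^'p \<Rightarrow> real^('q::finite + 'j::finite)^'p \<Rightarrow> real^'j^'j" where
  "Lam_J M R = (\<chi> i k. similar_mat M R $ Inr i $ Inr k)"

text \<open>When the eigenvalues are numbered by decreasing modulus with those of \<open>Lam_I\<close> first, the
  \<open>q\<close>-th one has the least modulus in the spectrum of \<open>Lam_I\<close> and the \<open>(q+1)\<close>-st one the largest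
  modulus in the spectrum of \<open>Lam_J\<close>; the last conjunct is the strict gap between these two.\<close>

definition spectral_split :: "real^'p^'p \<Rightarrow> real^('q::finite + 'j::finite)^'p \<Rightarrow> bool" where
  "spectral_split M R \<longleftrightarrow>
     invertible R \<and>
     (\<forall>i k. similar_mat M R $ Inr i $ Inl k = 0) \<and>
     spectrum (Lam_I M R) \<inter> spectrum (Lam_J M R) = {} \<and>
     cnj ` spectrum (Lam_I M R) = spectrum (Lam_I M R) \<and>
     (\<forall>z\<in>spectrum (Lam_I M R). \<forall>w\<in>spectrum (Lam_J M R). cmod z > cmod w)"


section \<open>Probabilistic notions\<close>

definition conv_in_prob :: "'w measure \<Rightarrow> (nat \<Rightarrow> 'w \<Rightarrow> 'b::metric_space) \<Rightarrow> 'b \<Rightarrow> bool" where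
  "conv_in_prob P X c \<longleftrightarrow>
     (\<forall>e>0. (\<lambda>T. measure P {\<omega>\<in>space P. dist (X T \<omega>) c > e}) \<longlonglongrightarrow> 0)"

definition bounded_in_prob :: "'w measure \<Rightarrow> (nat \<Rightarrow> 'w \<Rightarrow> 'b::real_normed_vector) \<Rightarrow> bool" where
  "bounded_in_prob P X \<longleftrightarrow>
     (\<forall>e>0. \<exists>K. \<forall>\<^sub>F T in sequentially. measure P {\<omega>\<in>space P. norm (X T \<omega>) > K} < e)"

text \<open>\<open>weak_conv_m\<close> is only available for measures on the real line; this is its counterpart for
  random vectors.\<close>

definition conv_in_distr ::
    "'w measure \<Rightarrow> (nat \<Rightarrow> 'w \<Rightarrow> 'b::euclidean_space) \<Rightarrow> 'b measure \<Rightarrow> bool" where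
  "conv_in_distr P X N \<longleftrightarrow>
     (\<forall>f :: 'b \<Rightarrow> real. continuous_on UNIV f \<and> bounded (range f) \<longrightarrow>
        (\<lambda>T. \<integral>\<omega>. f (X T \<omega>) \<partial>P) \<longlonglongrightarrow> (\<integral>x. f x \<partial>N))"

text \<open>The centred normal distribution with positive definite covariance matrix \<open>\<Omega>\<close>.\<close>

definition mv_normal :: "real^'n^'n \<Rightarrow> (real^'n) measure" where
  "mv_normal \<Omega> = density lborel (\<lambda>x. ennreal
     (exp (- (x \<bullet> (matrix_inv \<Omega> *v x)) / 2) / sqrt ((2 * pi) ^ CARD('n) * det \<Omega>)))"

text \<open>The law of the sum of the squares of \<open>k\<close> independent standard normal variables.\<close>

definition chi_square :: "nat \<Rightarrow> real measure" where
  "chi_square k = distr (PiM {..<k} (\<lambda>_. std_normal_distribution)) borel (\<lambda>x. \<Sum>i<k. (x i)\<^sup>2)"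


section \<open>The Wald statistic\<close>

definition sample_mean :: "(nat \<Rightarrow> 'w \<Rightarrow> 'b::real_vector) \<Rightarrow> nat \<Rightarrow> 'w \<Rightarrow> 'b" where
  "sample_mean X T \<omega> = (1 / real T) *\<^sub>R (\<Sum>t=1..T. X t \<omega>)"

definition proj_vec :: "real^'m^'p \<Rightarrow> real^('q::finite + 'j::finite)^'p \<Rightarrow> real^('p \<times> 'm)" where
  "proj_vec U R = vec_mat (transpose U ** block_I R ** transpose (block_I (left_basis R)))"

definition wald_B ::
    "real^'m^'p \<Rightarrow> real^'p^'p \<Rightarrow> real^('q::finite + 'j::finite)^'p \<Rightarrow> real^('p \<times> 'p)^('p \<times> 'm)" where
  "wald_B U M R =
     kron (block_I (left_basis R)) (transpose U ** block_J R) **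
     matrix_inv (kron (transpose (Lam_I M R)) (mat 1 :: real^'j^'j) -
                 kron (mat 1 :: real^'q^'q) (Lam_J M R)) **
     kron (transpose (block_I R)) (transpose (block_J (left_basis R)))"

definition wald_cov ::
    "real^'m^'p \<Rightarrow> real^'p^'p \<Rightarrow> real^('q::finite + 'j::finite)^'p \<Rightarrow> real^('p \<times> 'p)^('p \<times> 'p) \<Rightarrow>
     real^('p \<times> 'm)^('p \<times> 'm)" where
  "wald_cov U M R \<Omega> = wald_B U M R ** \<Omega> ** transpose (wald_B U M R)"

definition wald_stat ::
    "nat \<Rightarrow> real^'m^'p \<Rightarrow> real^('q::finite + 'j::finite)^'p \<Rightarrow> real^('p \<times> 'm)^('p \<times> 'm) \<Rightarrow> real" where
  "wald_stat T U R X = real T * (proj_vec U R \<bullet> (X *v proj_vec U R))"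

text \<open>The part of \<open>M\<close> carried by \<open>Lam_IJ\<close>. The block-triangular form determines the spans of
  \<open>block_I R\<close> and \<open>block_J (left_basis R)\<close>, but lets \<open>block_J R\<close> be an arbitrary complement of
  \<open>block_I R\<close>. \<open>coupling M R\<close> depends only on that complement, not on the bases: it vanishes if the
  complement is invariant too (\<open>R\<close> consists of bases of two right invariant subspaces), and it is
  large when the complement is close to being parallel to the span of \<open>block_I R\<close>. Requiring it
  to be bounded in probability for the sample decompositions rules out such degenerate complements;
  this holds in particular if the sample matrices \<open>R\<close> are consistent, or orthogonal.\<close>

definition coupling :: "real^'p^'p \<Rightarrow> real^('q::finite + 'j::finite)^'p \<Rightarrow> real^'p^'p" where
  "coupling M R = block_I R ** Lam_IJ M R ** transpose (block_J (left_basis R))"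

end

theory Submission
  imports Defs "HOL-Computational_Algebra.Fundamental_Theorem_Algebra"
begin

text \<open>Write \<open>E = M' - M\<close> for the error of an estimate \<open>M'\<close> of \<open>M\<close>. The dominant invariant subspace of \<open>M'\<close> is
  spanned by \<open>R\<^sub>I + R\<^sub>J Z\<close>, where \<open>Z\<close> is the small solution of a quadratic matrix equation
  (\<open>ex_riccati_branch\<close>). That equation is a Sylvester equation \<open>Z A - D Z = L\<^sub>J\<^sup>T E R\<^sub>I\<close> with coefficients close to
  \<open>\<Lambda>\<^sub>I\<close> and \<open>\<Lambda>\<^sub>J\<close> (\<open>riccati_sylvester\<close>). As the two blocks have no common eigenvalue, it can be solved for \<open>Z\<close>
  (\<open>invertible_sylvester\<close>). Under the null hypothesis \<open>U\<^sup>T R\<^sub>I = 0\<close>, so \<open>z = vec (U\<^sup>T (R\<^sub>I + R\<^sub>J Z))\<close> equals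
  \<open>C' vec E\<close>, where \<open>C'\<close> tends to the fixed Jacobian \<open>C\<close> of full row rank \<open>q m\<close>.

  The statistic is computed from arbitrary bases \<open>R'\<close> for \<open>M'\<close>. The gap of the moduli makes the invariant
  subspaces unique (\<open>spectral_split_unique\<close>), so both the vector and \<open>wald_B\<close> have the form \<open>L z\<close> and
  \<open>L C''\<close>, with one and the same left invertible \<open>L\<close> that contains all arbitrariness of the bases
  (\<open>two_splits_wald_B\<close>). A generalized inverse of \<open>L S L\<^sup>T\<close> acts as \<open>S\<^sup>-\<^sup>1\<close> on the range of \<open>L\<close>
  (\<open>sandwich_generalized_inverse\<close>), and the statistic becomes \<open>T z\<^sup>T S\<^sup>-\<^sup>1 z\<close> with \<open>S = C'' \<Omega>' C''\<^sup>T\<close>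
  for the estimate \<open>\<Omega>'\<close> of \<open>\<Omega>\<close>. The
  complement chosen in \<open>R'\<close> influences \<open>C''\<close> by a term of the order of \<open>Z\<close> times the coupling, so that
  \<open>C''\<close> tends to \<open>C\<close> as long as the coupling stays bounded. Hence the statistic differs from the continuous function
  \<open>(C x)\<^sup>T (C \<Omega> C\<^sup>T)\<^sup>-\<^sup>1 C x\<close> of \<open>x = \<surd>T vec E\<close> by a quantity that tends to \<open>0\<close> uniformly for bounded \<open>x\<close>
  (\<open>wald_stat_uniform_approximation\<close>), and the limit law of \<open>x\<close> can be inserted
  (\<open>weak_conv_of_approximation\<close>).

  Finally, in \<open>\<Omega>\<^sup>-\<^sup>1\<close>-orthonormal coordinates adapted to the range of \<open>\<Omega> C\<^sup>T\<close>, a normal vector has independent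
  standard normal coordinates and the function is the sum of \<open>q m\<close> of their squares
  (\<open>distr_quadratic_form_chi_square\<close>).\<close>


section \<open>Rectangular matrices\<close>

(* This rule turns transpose A *v x into x v* A and so hides the adjoint from the rules below. *)
declare transpose_matrix_vector [simp del]

lemma norm_matrix_vector_le:
  fixes A :: "real^'n^'m" and x :: "real^'n"
  shows "norm (A *v x) \<le> norm A * norm x"
proof -
  have "norm (A *v x) = L2_set (\<lambda>i. \<bar>(A *v x) $ i\<bar>) UNIV"
    by (simp add: norm_vec_def)
  also have "\<dots> \<le> L2_set (\<lambda>i. norm (A $ i) * norm x) UNIV"
    by (intro L2_set_mono) (auto simp: matrix_vector_mul_component Cauchy_Schwarz_ineq2)
  also have "\<dots> = norm A * norm x"
    by (simp add: L2_set_left_distrib norm_vec_def[of A])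
  finally show ?thesis .
qed

lemma bounded_bilinear_matrix_vector:
  "bounded_bilinear (\<lambda>(A :: real^'n^'m) x. A *v x)"
  by unfold_locales
    (auto simp: matrix_vector_mult_add_rdistrib matrix_vector_right_distrib
        scaleR_matrix_vector_assoc matrix_vector_mult_scaleR intro!: exI[of _ 1] norm_matrix_vector_le)

lemma norm_matrix_matrix_le:
  fixes A :: "real^'n^'m" and B :: "real^'k^'n"
  shows "norm (A ** B) \<le> norm A * norm B"
proof -
  have "(A ** B) $ i = transpose B *v (A $ i)" for i
    by (simp add: vec_eq_iff matrix_matrix_mult_def matrix_vector_mult_def transpose_def mult.commute)
  moreover have "norm (transpose B) = norm B"
    by (simp add: norm_eq_sqrt_inner inner_vec_def transpose_def) (rule sum.swap)
  ultimately have "norm ((A ** B) $ i) \<le> norm B * norm (A $ i)" for i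
    using norm_matrix_vector_le[of "transpose B" "A $ i"] by simp
  then have "L2_set (\<lambda>i. norm ((A ** B) $ i)) UNIV \<le> L2_set (\<lambda>i. norm (A $ i) * norm B) UNIV"
    by (intro L2_set_mono) (auto simp: mult.commute)
  then show ?thesis
    by (simp add: L2_set_left_distrib norm_vec_def[of A] norm_vec_def[of "A ** B"])
qed

lemma bounded_bilinear_matrix_matrix:
  "bounded_bilinear (\<lambda>(A :: real^'n^'m) (B :: real^'k^'n). A ** B)"
proof
  show "\<exists>K. \<forall>(A :: real^'n^'m) (B :: real^'k^'n). norm (A ** B) \<le> norm A * norm B * K"
    by (intro exI[of _ 1]) (simp add: norm_matrix_matrix_le)
qed (simp_all add: vec_eq_iff matrix_matrix_mult_def algebra_simps sum.distrib sum_distrib_left)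

lemmas mm_add_left = bounded_bilinear.add_left[OF bounded_bilinear_matrix_matrix]
  and mm_add_right = bounded_bilinear.add_right[OF bounded_bilinear_matrix_matrix]
  and mm_diff_left = bounded_bilinear.diff_left[OF bounded_bilinear_matrix_matrix]
  and mm_diff_right = bounded_bilinear.diff_right[OF bounded_bilinear_matrix_matrix]
  and mm_minus_left = bounded_bilinear.minus_left[OF bounded_bilinear_matrix_matrix]
  and mm_minus_right = bounded_bilinear.minus_right[OF bounded_bilinear_matrix_matrix]
  and mm_zero_left [simp] = bounded_bilinear.zero_left[OF bounded_bilinear_matrix_matrix]
  and mm_zero_right [simp] = bounded_bilinear.zero_right[OF bounded_bilinear_matrix_matrix]
  and tendsto_mm [tendsto_intros] = bounded_bilinear.tendsto[OF bounded_bilinear_matrix_matrix]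
  and tendsto_mv [tendsto_intros] = bounded_bilinear.tendsto[OF bounded_bilinear_matrix_vector]
  and continuous_on_mm [continuous_intros] =
    bounded_bilinear.continuous_on[OF bounded_bilinear_matrix_matrix]
  and continuous_on_mv [continuous_intros] =
    bounded_bilinear.continuous_on[OF bounded_bilinear_matrix_vector]

lemmas mm_distribs = mm_add_left mm_add_right mm_diff_left mm_diff_right mm_minus_left mm_minus_right

lemma transpose_add: "transpose (A + B) = transpose A + transpose (B :: real^'n^'m)"
  by (simp add: transpose_def vec_eq_iff)

lemma bounded_linear_transpose: "bounded_linear (transpose :: real^'n^'m \<Rightarrow> real^'m^'n)"
  by (intro linear_conv_bounded_linear[THEN iffD1] linearI) (auto simp: transpose_add transpose_scalar)

lemmas tendsto_transpose [tendsto_intros] = bounded_linear.tendsto[OF bounded_linear_transpose]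
  and continuous_on_transpose [continuous_intros] =
    bounded_linear.continuous_on[OF bounded_linear_transpose]

lemma inner_transpose_mv: "x \<bullet> (A *v y) = (transpose A *v x) \<bullet> (y :: real^'n)"
  by (simp add: dot_lmul_matrix transpose_matrix_vector)

lemma matrix_inv_unique:
  fixes A :: "real^'n^'m"
  assumes "A ** X = mat 1" "X ** A = mat 1"
  shows "matrix_inv A = X"
proof -
  have "A ** matrix_inv A = mat 1 \<and> matrix_inv A ** A = mat 1"
    unfolding matrix_inv_def by (rule someI[of _ X]) (use assms in auto)
  then show ?thesis
    by (metis assms(2) matrix_mul_assoc matrix_mul_lid matrix_mul_rid)
qed

lemma matrix_inv_mult:
  fixes A :: "real^'n^'m"
  assumes "invertible A"
  shows "A ** matrix_inv A = mat 1" "matrix_inv A ** A = mat 1"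
proof -
  have "A ** matrix_inv A = mat 1 \<and> matrix_inv A ** A = mat 1"
    unfolding matrix_inv_def by (rule someI_ex) (use assms in \<open>auto simp: invertible_def\<close>)
  then show "A ** matrix_inv A = mat 1" "matrix_inv A ** A = mat 1" by auto
qed

text \<open>\<open>matrix_inv\<close> is a choice, which for a matrix without inverse is made from the empty set. So it takes
  one and the same value on all such matrices, which keeps it Borel measurable.\<close>

lemma matrix_inv_not_invertible:
  assumes "\<not> invertible A"
  shows "matrix_inv A = (SOME X. False)"
proof -
  have "(\<lambda>X. A ** X = mat 1 \<and> X ** A = mat 1) = (\<lambda>X. False)"
    using assms unfolding invertible_def by blast
  then show ?thesis unfolding matrix_inv_def by (rule arg_cong)
qed

text \<open>The entries of the inverse are rational functions of the entries of the matrix, so inversion is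
  continuous where the determinant does not vanish.\<close>

lemma matrix_inv_cramer:
  fixes A :: "real^'n^'n"
  assumes "invertible A"
  shows "matrix_inv A $ k $ l = det (\<chi> i j. if j = k then axis l 1 $ i else A $ i $ j) / det A"
proof -
  have "A *v (matrix_inv A *v axis l 1) = axis l 1"
    by (simp add: matrix_vector_mul_assoc matrix_inv_mult assms)
  then have "matrix_inv A *v axis l 1 =
      (\<chi> k. det (\<chi> i j. if j = k then axis l 1 $ i else A $ i $ j) / det A)"
    using cramer[of A] assms invertible_det_nz by blast
  then show ?thesis
    by (simp add: vec_eq_iff matrix_vector_mult_basis column_def)
qed

lemma tendsto_matrix_nth [tendsto_intros]:
  "(f \<longlongrightarrow> A) F \<Longrightarrow> ((\<lambda>x. f x $ i $ j) \<longlongrightarrow> A $ i $ j) F"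
  by (intro tendsto_vec_nth)

lemma tendsto_matrixI:
  fixes f :: "'b \<Rightarrow> 'a::topological_space^'n^'m"
  assumes "\<And>i j. ((\<lambda>x. f x $ i $ j) \<longlongrightarrow> A $ i $ j) F"
  shows "(f \<longlongrightarrow> A) F"
  by (intro vec_tendstoI assms)

lemma continuous_on_det [continuous_intros]:
  fixes f :: "'a::topological_space \<Rightarrow> real^'n^'n"
  assumes "continuous_on S f"
  shows "continuous_on S (\<lambda>x. det (f x))"
  unfolding det_def by (intro continuous_intros continuous_on_component assms)

lemma tendsto_det:
  fixes f :: "'a \<Rightarrow> real^'n^'n"
  assumes "(f \<longlongrightarrow> A) F"
  shows "((\<lambda>x. det (f x)) \<longlongrightarrow> det A) F"
  unfolding det_def by (intro tendsto_intros assms)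

lemma eventually_invertible:
  fixes f :: "'a \<Rightarrow> real^'n^'n"
  assumes "(f \<longlongrightarrow> A) F" "invertible A"
  shows "\<forall>\<^sub>F x in F. invertible (f x)"
  using tendsto_imp_eventually_ne[OF tendsto_det[OF assms(1)], of 0] assms(2)
  by (simp add: invertible_det_nz)

lemma tendsto_matrix_inv:
  fixes f :: "'a \<Rightarrow> real^'n^'n"
  assumes lim: "(f \<longlongrightarrow> A) F" and inv: "invertible A"
  shows "((\<lambda>x. matrix_inv (f x)) \<longlongrightarrow> matrix_inv A) F"
proof (rule tendsto_matrixI)
  fix k l
  let ?g = "\<lambda>B :: real^'n^'n. det (\<chi> i j. if j = k then axis l 1 $ i else B $ i $ j) / det B"
  have "((\<lambda>x. ?g (f x)) \<longlongrightarrow> ?g A) F"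
  proof (intro tendsto_divide tendsto_det lim tendsto_matrixI)
    fix i j
    show "((\<lambda>x. (\<chi> i j. if j = k then axis l 1 $ i else f x $ i $ j) $ i $ j) \<longlongrightarrow>
        (\<chi> i j. if j = k then axis l 1 $ i else A $ i $ j) $ i $ j) F"
      by (cases "j = k") (auto intro: tendsto_intros lim)
  qed (use inv invertible_det_nz in auto)
  moreover have "\<forall>\<^sub>F x in F. ?g (f x) = matrix_inv (f x) $ k $ l"
    using eventually_invertible[OF lim inv]
    by eventually_elim (simp add: matrix_inv_cramer)
  ultimately show "((\<lambda>x. matrix_inv (f x) $ k $ l) \<longlongrightarrow> matrix_inv A $ k $ l) F"
    using matrix_inv_cramer[OF inv, of k l] by (simp add: Lim_transform_eventually)
qed

lemma borel_measurable_matrix_inv_square: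
  "(matrix_inv :: real^'n^'n \<Rightarrow> real^'n^'n) \<in> borel_measurable borel"
proof -
  let ?S = "{A :: real^'n^'n. det A \<noteq> 0}"
  have "open ?S"
    by (intro open_Collect_neq continuous_intros)
  have "continuous_on ?S (matrix_inv :: real^'n^'n \<Rightarrow> real^'n^'n)"
    unfolding continuous_on_def
    by (auto intro!: tendsto_matrix_inv tendsto_ident_at simp: invertible_det_nz)
  then have "(\<lambda>A. if A \<in> ?S then matrix_inv A else (SOME X :: real^'n^'n. False)) \<in> borel_measurable borel"
    using \<open>open ?S\<close> by (intro borel_measurable_continuous_on_if continuous_on_const) auto
  also have "(\<lambda>A. if A \<in> ?S then matrix_inv A else (SOME X. False)) = matrix_inv"
    by (auto simp: fun_eq_iff invertible_det_nz[symmetric] matrix_inv_not_invertible)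
  finally show ?thesis .
qed

text \<open>Matrices that are square up to a renaming of the rows are reduced to square ones by a fixed
  invertible matrix of the same shape; without such a matrix, \<open>matrix_inv\<close> is constant.\<close>

lemma borel_measurable_matrix_inv [measurable]:
  "(matrix_inv :: real^'n^'m \<Rightarrow> real^'m^'n) \<in> borel_measurable borel"
proof (cases "\<exists>A :: real^'n^'m. invertible A")
  case False
  then have "matrix_inv A = (SOME X. False)" for A :: "real^'n^'m"
    using matrix_inv_not_invertible by blast
  then have eq: "(matrix_inv :: real^'n^'m \<Rightarrow> real^'m^'n) = (\<lambda>_. SOME X. False)"
    by (rule ext)
  show ?thesis by (subst eq) (rule borel_measurable_const)
next
  case True
  then obtain A0 :: "real^'n^'m" where A0: "invertible A0" by blast
  note A0_inv = matrix_inv_mult[OF A0]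
  have A0': "invertible (matrix_inv A0)"
    using A0_inv invertible_def by blast
  have cancel: "A ** matrix_inv A0 ** A0 = A" for A :: "real^'n^'m"
    by (simp add: matrix_mul_assoc[symmetric] A0_inv)
  have inv_iff: "invertible A \<longleftrightarrow> invertible (A ** matrix_inv A0)" for A :: "real^'n^'m"
    using invertible_mult[OF _ A0', of A] invertible_mult[OF _ A0, of "A ** matrix_inv A0"]
    unfolding cancel by blast
  have eq: "matrix_inv A = matrix_inv A0 ** matrix_inv (A ** matrix_inv A0)"
    if "invertible A" for A :: "real^'n^'m"
  proof (rule matrix_inv_unique)
    note B = that[unfolded inv_iff]
    show "A ** (matrix_inv A0 ** matrix_inv (A ** matrix_inv A0)) = mat 1"
      using matrix_inv_mult(1)[OF B] by (simp add: matrix_mul_assoc)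
    have "matrix_inv A0 ** matrix_inv (A ** matrix_inv A0) ** (A ** matrix_inv A0 ** A0) =
        matrix_inv A0 ** (matrix_inv (A ** matrix_inv A0) ** (A ** matrix_inv A0)) ** A0"
      by (simp add: matrix_mul_assoc)
    then show "matrix_inv A0 ** matrix_inv (A ** matrix_inv A0) ** A = mat 1"
      by (simp add: matrix_inv_mult(2)[OF B] cancel A0_inv)
  qed
  have "(\<lambda>A :: real^'n^'m. if det (A ** matrix_inv A0) \<noteq> 0
      then matrix_inv A0 ** matrix_inv (A ** matrix_inv A0) else (SOME X. False)) \<in> borel_measurable borel"
  proof (intro measurable_If)
    have *: "(\<lambda>A :: real^'n^'m. A ** matrix_inv A0) \<in> borel_measurable borel"
      by (intro borel_measurable_continuous_onI continuous_intros)
    show "(\<lambda>A :: real^'n^'m. matrix_inv A0 ** matrix_inv (A ** matrix_inv A0)) \<in> borel_measurable borel"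
      by (rule borel_measurable_continuous_on[OF _ measurable_compose[OF * borel_measurable_matrix_inv_square]])
        (intro continuous_intros)
    show "{A :: real^'n^'m \<in> space borel. det (A ** matrix_inv A0) \<noteq> 0} \<in> sets borel"
      by (simp, intro borel_open open_Collect_neq continuous_intros)
  qed simp
  also have "(\<lambda>A :: real^'n^'m. if det (A ** matrix_inv A0) \<noteq> 0
      then matrix_inv A0 ** matrix_inv (A ** matrix_inv A0) else (SOME X. False)) = matrix_inv"
  proof
    fix A :: "real^'n^'m"
    show "(if det (A ** matrix_inv A0) \<noteq> 0
        then matrix_inv A0 ** matrix_inv (A ** matrix_inv A0) else (SOME X. False)) = matrix_inv A"
    proof (cases "invertible A")
      case True
      with inv_iff eq show ?thesis by (simp add: invertible_det_nz)
    next
      case False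
      then have "matrix_inv A = (SOME X. False)"
        by (rule matrix_inv_not_invertible)
      with False inv_iff show ?thesis by (simp add: invertible_det_nz)
    qed
  qed
  finally show ?thesis .
qed

section \<open>Vectorization and Kronecker products\<close>

definition unvec :: "real^('n \<times> 'm) \<Rightarrow> real^'n^'m" where
  "unvec x = (\<chi> i j. x $ (j, i))"

lemma vec_mat_unvec [simp]: "vec_mat (unvec x) = x"
  and unvec_vec_mat [simp]: "unvec (vec_mat X) = X"
  by (simp_all add: vec_mat_def unvec_def vec_eq_iff)

lemma vec_mat_eq_iff: "vec_mat X = vec_mat Y \<longleftrightarrow> X = (Y :: real^'n^'m)"
  by (metis unvec_vec_mat)

lemma vec_mat_add: "vec_mat (X + Y) = vec_mat X + vec_mat (Y :: real^'n^'m)"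
  and vec_mat_diff: "vec_mat (X - Y) = vec_mat X - vec_mat (Y :: real^'n^'m)"
  and vec_mat_scaleR: "vec_mat (c *\<^sub>R X) = c *\<^sub>R vec_mat (X :: real^'n^'m)"
  and vec_mat_zero [simp]: "vec_mat (0 :: real^'n^'m) = 0"
  by (simp_all add: vec_mat_def vec_eq_iff)

lemma bounded_linear_vec_mat: "bounded_linear (vec_mat :: real^'n^'m \<Rightarrow> real^('n \<times> 'm))"
  by (intro linear_conv_bounded_linear[THEN iffD1] linearI) (auto simp: vec_mat_add vec_mat_scaleR)

lemmas tendsto_vec_mat [tendsto_intros] = bounded_linear.tendsto[OF bounded_linear_vec_mat]
  and continuous_on_vec_mat [continuous_intros] =
    bounded_linear.continuous_on[OF bounded_linear_vec_mat]

lemma norm_vec_mat: "norm (vec_mat X) = norm (X :: real^'n^'m)"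
proof -
  have "(\<Sum>k\<in>UNIV. X $ snd k $ fst k * X $ snd k $ fst k) =
      (\<Sum>j\<in>UNIV. \<Sum>i\<in>UNIV. X $ i $ j * X $ i $ j)"
    by (simp add: UNIV_Times_UNIV[symmetric] sum.cartesian_product case_prod_beta del: UNIV_Times_UNIV)
  also have "\<dots> = (\<Sum>i\<in>UNIV. \<Sum>j\<in>UNIV. X $ i $ j * X $ i $ j)"
    by (rule sum.swap)
  finally show ?thesis
    by (simp add: norm_eq_sqrt_inner inner_vec_def vec_mat_def)
qed

lemma kron_vec_mat:
  fixes A :: "real^'k^'l" and B :: "real^'n^'m"
  shows "kron A B *v vec_mat X = vec_mat (B ** X ** transpose A)"
proof (simp add: vec_eq_iff, intro allI)
  fix a b
  have "(kron A B *v vec_mat X) $ (a, b) = (\<Sum>j\<in>UNIV. \<Sum>i\<in>UNIV. A $ a $ j * B $ b $ i * X $ i $ j)"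
    by (simp add: kron_def matrix_vector_mult_def vec_mat_def UNIV_Times_UNIV[symmetric]
        sum.cartesian_product case_prod_beta del: UNIV_Times_UNIV)
  also have "\<dots> = vec_mat (B ** X ** transpose A) $ (a, b)"
    by (simp add: vec_mat_def matrix_matrix_mult_def transpose_def sum_distrib_left sum_distrib_right mult_ac)
  finally show "(kron A B *v vec_mat X) $ (a, b) = vec_mat (B ** X ** transpose A) $ (a, b)" .
qed

lemma matrix_eq_on_vec_mat:
  fixes A B :: "real^('n::finite \<times> 'm::finite)^'k"
  assumes "\<And>X. A *v vec_mat X = B *v vec_mat X"
  shows "A = B"
  by (metis assms matrix_eq vec_mat_unvec)

lemma kron_mult:
  fixes A :: "real^'k^'l" and B :: "real^'n^'m" and C :: "real^'a^'k" and D :: "real^'b^'n"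
  shows "kron A B ** kron C D = kron (A ** C) (B ** D)"
  by (rule matrix_eq_on_vec_mat)
    (simp add: matrix_vector_mul_assoc[symmetric] kron_vec_mat matrix_transpose_mul matrix_mul_assoc)

lemma kron_mat_1 [simp]: "kron (mat 1 :: real^'n^'n) (mat 1 :: real^'m^'m) = mat 1"
  by (rule matrix_eq_on_vec_mat) (simp add: kron_vec_mat)

lemma tendsto_kron [tendsto_intros]:
  fixes f :: "'x \<Rightarrow> real^'k^'l" and g :: "'x \<Rightarrow> real^'n^'m"
  assumes "(f \<longlongrightarrow> A) F" "(g \<longlongrightarrow> B) F"
  shows "((\<lambda>x. kron (f x) (g x)) \<longlongrightarrow> kron A B) F"
  by (rule tendsto_matrixI) (auto simp: kron_def intro!: tendsto_intros assms)

section \<open>Sylvester equations\<close>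

text \<open>The matrix of the linear map \<open>Y \<mapsto> Y A - D Y\<close>. Its inverse is the middle factor of \<open>wald_B\<close>.\<close>

definition sylvester :: "real^'q^'q \<Rightarrow> real^'j^'j \<Rightarrow> real^('q \<times> 'j)^('q \<times> 'j)" where
  "sylvester A D = kron (transpose A) (mat 1) - kron (mat 1) D"

lemma sylvester_vec_mat: "sylvester A D *v vec_mat Y = vec_mat (Y ** A - D ** Y)"
  by (simp add: sylvester_def matrix_vector_mult_diff_rdistrib kron_vec_mat vec_mat_diff)

text \<open>The vector \<open>p(f) v\<close>.\<close>

definition poly_operator :: "('a::comm_semiring_1^'n \<Rightarrow> 'a^'n) \<Rightarrow> 'a poly \<Rightarrow> 'a^'n \<Rightarrow> 'a^'n" where
  "poly_operator f p = fold_coeffs (\<lambda>a g v. a *s v + g (f v)) p (\<lambda>_. 0)"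

lemma poly_operator_0: "poly_operator f 0 v = 0"
  by (simp add: poly_operator_def)

lemma poly_operator_pCons: "poly_operator f (pCons a p) v = a *s v + poly_operator f p (f v)"
  by (cases "p = 0"; cases "a = 0") (auto simp: poly_operator_def)

lemma poly_operator_add: "poly_operator f (p + q) v = poly_operator f p v + poly_operator f q v"
  by (induction p q arbitrary: v rule: poly_induct2)
    (simp_all add: poly_operator_0 poly_operator_pCons vector_sadd_rdistrib algebra_simps)

lemma poly_operator_smult: "poly_operator f (smult c p) v = c *s poly_operator f p v"
  by (induction p arbitrary: v)
    (simp_all add: poly_operator_0 poly_operator_pCons vector_add_ldistrib vector_smult_assoc)

lemma poly_operator_monom: "poly_operator f (monom c n) v = c *s (f ^^ n) v"
  by (induction n arbitrary: v) (simp_all add: poly_operator_0 poly_operator_pCons monom_0 monom_Suc funpow_swap1)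

lemma poly_operator_sum: "poly_operator f (\<Sum>i\<in>I. g i) v = (\<Sum>i\<in>I. poly_operator f (g i) v)"
  by (induction I rule: infinite_finite_induct) (simp_all add: poly_operator_0 poly_operator_add)

lemma poly_operator_linear:
  fixes B :: "complex^'n^'n"
  shows "poly_operator ((*v) B) p (v + w) = poly_operator ((*v) B) p v + poly_operator ((*v) B) p w"
    and "poly_operator ((*v) B) p (c *s v) = c *s poly_operator ((*v) B) p v"
    and "poly_operator ((*v) B) p (B *v v) = B *v poly_operator ((*v) B) p v"
proof -
  show "poly_operator ((*v) B) p (v + w) = poly_operator ((*v) B) p v + poly_operator ((*v) B) p w" for v w
    by (induction p arbitrary: v w)
      (simp_all add: poly_operator_0 poly_operator_pCons vector_add_ldistrib matrix_vector_right_distrib)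
  show "poly_operator ((*v) B) p (c *s v) = c *s poly_operator ((*v) B) p v"
    by (induction p arbitrary: v)
      (simp_all add: poly_operator_0 poly_operator_pCons vector_add_ldistrib vector_scalar_commute vector_smult_assoc mult.commute)
  show "poly_operator ((*v) B) p (B *v v) = B *v poly_operator ((*v) B) p v"
    by (induction p arbitrary: v)
      (simp_all add: poly_operator_0 poly_operator_pCons matrix_vector_right_distrib vector_scalar_commute)
qed

lemma poly_operator_linear_factor:
  fixes B :: "complex^'n^'n"
  shows "poly_operator ((*v) B) ([:-\<mu>, 1:] * p) v = poly_operator ((*v) B) p (B *v v - \<mu> *s v)"
proof -
  have "poly_operator ((*v) B) ([:-\<mu>, 1:] * p) v = (- \<mu>) *s poly_operator ((*v) B) p v + poly_operator ((*v) B) p (B *v v)"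
    by (simp only: mult_pCons_left poly_operator_add poly_operator_smult poly_operator_pCons mult_zero_left) (simp add: poly_operator_0)
  also have "\<dots> = poly_operator ((*v) B) p ((- \<mu>) *s v + B *v v)"
    by (simp only: poly_operator_linear)
  finally show ?thesis by simp
qed

text \<open>The iterates \<open>v, B v, B\<^sup>2 v, \<dots>\<close> up to the real dimension of the space are linearly dependent.\<close>

lemma ex_annihilating_poly:
  fixes B :: "complex^'n^'n"
  obtains p where "p \<noteq> 0" "poly_operator ((*v) B) p v = 0"
proof -
  let ?g = "\<lambda>i. (((*v) B) ^^ i) v" and ?N = "Suc (DIM(complex^'n))"
  have "\<exists>c. (\<exists>i<?N. c i \<noteq> 0) \<and> (\<Sum>i<?N. c i *\<^sub>R ?g i) = 0"
  proof (cases "inj_on ?g {..<?N}")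
    case True
    then have "card (?g ` {..<?N}) = ?N" by (simp add: card_image)
    then have "dependent (?g ` {..<?N})"
      using independent_bound[of "?g ` {..<?N}"] by linarith
    then obtain u where u: "\<exists>w\<in>?g ` {..<?N}. u w \<noteq> 0" "(\<Sum>w\<in>?g ` {..<?N}. u w *\<^sub>R w) = 0"
      using dependent_finite[of "?g ` {..<?N}"] by blast
    then have "(\<Sum>i<?N. u (?g i) *\<^sub>R ?g i) = 0"
      using True by (simp add: sum.reindex)
    with u(1) show ?thesis by (intro exI[of _ "u \<circ> ?g"]) auto
  next
    case False
    then obtain i j where ij: "i < ?N" "j < ?N" "i \<noteq> j" "?g i = ?g j"
      by (auto simp: inj_on_def)
    let ?c = "\<lambda>k. if k = i then 1 else if k = j then - 1 else (0::real)"
    have "(\<Sum>k<?N. ?c k *\<^sub>R ?g k) = (\<Sum>k\<in>{i, j}. ?c k *\<^sub>R ?g k)"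
      using ij by (intro sum.mono_neutral_right) auto
    also have "\<dots> = 0" using ij by simp
    finally show ?thesis using ij by (intro exI[of _ ?c]) auto
  qed
  then obtain c i where c: "i < ?N" "c i \<noteq> 0" "(\<Sum>i<?N. c i *\<^sub>R ?g i) = 0" by blast
  define p where "p = (\<Sum>i<?N. monom (complex_of_real (c i)) i)"
  have scaleR: "complex_of_real r *s w = r *\<^sub>R w" for r and w :: "complex^'n"
    unfolding vec_eq_iff vector_scaleR_component vector_smult_component by (simp add: scaleR_conv_of_real)
  have "coeff p i = complex_of_real (c i)"
    using c(1) by (simp add: p_def coeff_sum)
  then have "p \<noteq> 0" using c(2) by auto
  moreover have "poly_operator ((*v) B) p v = 0"
    using c(3) by (simp only: p_def poly_operator_sum poly_operator_monom scaleR)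
  ultimately show ?thesis by (rule that)
qed

text \<open>Split an annihilating polynomial of \<open>B\<close> at \<open>v\<close> into linear factors. A factor \<open>B - \<mu>\<close> can be
  moved across \<open>Y\<close>, where it becomes \<open>A - \<mu>\<close>; one of the two is injective, so it can be cancelled.\<close>

lemma sylvester_kernel_complex:
  fixes A :: "complex^'m^'m" and B :: "complex^'n^'n" and Y :: "complex^'n^'m"
  assumes comm: "\<And>v. A *v (Y *v v) = Y *v (B *v v)"
    and disj: "\<And>z. (\<forall>v. A *v v = z *s v \<longrightarrow> v = 0) \<or> (\<forall>v. B *v v = z *s v \<longrightarrow> v = 0)"
  shows "Y *v v = 0"
proof -
  have "Y *v v = 0" if "p \<noteq> 0" "poly_operator ((*v) B) p v = 0" for p v
    using that
  proof (induction "degree p" arbitrary: p v)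
    case 0
    then obtain c where "p = [:c:]" "c \<noteq> 0"
      by (metis degree_eq_zeroE pCons_eq_0_iff)
    with 0 show ?case by (simp add: poly_operator_pCons poly_operator_0)
  next
    case (Suc n)
    then have "\<not> constant (poly p)" by (simp add: constant_degree)
    then obtain \<mu> where "poly p \<mu> = 0"
      using fundamental_theorem_of_algebra by blast
    then obtain q where q: "p = [:-\<mu>, 1:] * q"
      by (metis poly_eq_0_iff_dvd dvdE)
    with Suc.prems have "q \<noteq> 0" by auto
    then have "degree p = Suc (degree q)"
      unfolding q by (subst degree_mult_eq) auto
    then have deg: "n = degree q" using Suc.hyps by simp
    have ann: "poly_operator ((*v) B) q (B *v v - \<mu> *s v) = 0"
      using Suc.prems(2) by (simp only: q poly_operator_linear_factor)
    from disj[of \<mu>] show ?case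
    proof
      assume A: "\<forall>v. A *v v = \<mu> *s v \<longrightarrow> v = 0"
      have "Y *v (B *v v - \<mu> *s v) = 0"
        using Suc.hyps(1)[OF deg \<open>q \<noteq> 0\<close> ann] .
      then have "A *v (Y *v v) = \<mu> *s (Y *v v)"
        by (simp add: matrix_vector_mult_diff_distrib comm vector_scalar_commute)
      then show ?thesis using A by blast
    next
      assume B: "\<forall>v. B *v v = \<mu> *s v \<longrightarrow> v = 0"
      have "poly_operator ((*v) B) q (B *v v + (- \<mu>) *s v) = 0"
        using ann by simp
      then have "B *v poly_operator ((*v) B) q v = \<mu> *s poly_operator ((*v) B) q v"
        by (simp only: poly_operator_linear) simp
      then have "poly_operator ((*v) B) q v = 0" using B by blast
      then show ?thesis using Suc.hyps(1)[OF deg \<open>q \<noteq> 0\<close>] by blast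
    qed
  qed
  moreover obtain p where "p \<noteq> 0" "poly_operator ((*v) B) p v = 0"
    by (rule ex_annihilating_poly)
  ultimately show ?thesis by blast
qed

lemma map_of_real_mult:
  fixes A :: "real^'n^'m" and B :: "real^'k^'n"
  shows "map_matrix complex_of_real (A ** B) = map_matrix of_real A ** map_matrix of_real B"
  by (simp add: vec_eq_iff matrix_matrix_mult_def)

lemma sylvester_kernel:
  fixes A :: "real^'m^'m" and B :: "real^'n^'n" and Y :: "real^'n^'m"
  assumes comm: "A ** Y = Y ** B" and disj: "spectrum A \<inter> spectrum B = {}"
  shows "Y = 0"
proof -
  let ?c = "map_matrix complex_of_real"
  have "?c Y *v v = 0" for v
  proof (rule sylvester_kernel_complex)
    show "?c A *v (?c Y *v v) = ?c Y *v (?c B *v v)" for v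
      using arg_cong[OF comm, of ?c] by (simp add: map_of_real_mult matrix_vector_mul_assoc)
    show "(\<forall>v. ?c A *v v = z *s v \<longrightarrow> v = 0) \<or> (\<forall>v. ?c B *v v = z *s v \<longrightarrow> v = 0)" for z
      using disj by (auto simp: spectrum_def)
  qed
  then have "?c Y *v v = 0 *v v" for v by simp
  then have "?c Y = 0" using matrix_eq by blast
  then show ?thesis by (simp add: vec_eq_iff)
qed

text \<open>The kernel of the Sylvester map is trivial, and it acts on a space of finite dimension.\<close>

lemma invertible_sylvester:
  fixes A :: "real^'q^'q" and D :: "real^'j^'j"
  assumes "spectrum A \<inter> spectrum D = {}"
  shows "invertible (sylvester A D)"
proof -
  have "x = 0" if "sylvester A D *v x = 0" for x
  proof -
    have "vec_mat (unvec x ** A - D ** unvec x) = vec_mat 0"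
      using that sylvester_vec_mat[of A D "unvec x"] by simp
    then have "D ** unvec x = unvec x ** A"
      by (simp only: vec_mat_eq_iff) simp
    then have "unvec x = 0" using sylvester_kernel assms by blast
    then show "x = 0" by (metis vec_mat_unvec vec_mat_zero)
  qed
  then show ?thesis
    by (metis invertible_left_inverse matrix_left_invertible_ker)
qed

lemma tendsto_sylvester [tendsto_intros]:
  fixes f :: "'a \<Rightarrow> real^'q^'q" and g :: "'a \<Rightarrow> real^'j^'j"
  shows "(f \<longlongrightarrow> A) F \<Longrightarrow> (g \<longlongrightarrow> D) F \<Longrightarrow> ((\<lambda>x. sylvester (f x) (g x)) \<longlongrightarrow> sylvester A D) F"
  unfolding sylvester_def by (intro tendsto_intros)

section \<open>Spectral splits\<close>

lemma sum_UNIV_Plus: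
  fixes f :: "'a::finite + 'b::finite \<Rightarrow> 'c::comm_monoid_add"
  shows "(\<Sum>k\<in>UNIV. f k) = (\<Sum>a\<in>UNIV. f (Inl a)) + (\<Sum>b\<in>UNIV. f (Inr b))"
  by (simp add: UNIV_Plus_UNIV[symmetric] sum.Plus del: UNIV_Plus_UNIV)

text \<open>The rows of \<open>R\<^sup>-\<^sup>1\<close> that belong to the two blocks of columns of \<open>R\<close>: the transposes of the blocks
  \<open>L\<^sub>I\<close> and \<open>L\<^sub>J\<close>.\<close>

abbreviation left_I :: "real^('q::finite + 'j::finite)^'p \<Rightarrow> real^'p^'q" where
  "left_I R \<equiv> transpose (block_I (left_basis R))"

abbreviation left_J :: "real^('q::finite + 'j::finite)^'p \<Rightarrow> real^'p^'j" where
  "left_J R \<equiv> transpose (block_J (left_basis R))"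

lemma left_I_nth: "left_I R $ k $ i = matrix_inv R $ Inl k $ i"
  and left_J_nth: "left_J R $ l $ i = matrix_inv R $ Inr l $ i"
  by (simp_all add: block_I_def block_J_def left_basis_def transpose_def)

lemma block_products:
  fixes R :: "real^('q::finite + 'j::finite)^'p"
  assumes "invertible R"
  shows "left_I R ** block_I R = mat 1" "left_I R ** block_J R = 0"
    "left_J R ** block_I R = 0" "left_J R ** block_J R = mat 1"
    "block_I R ** left_I R + block_J R ** left_J R = mat 1"
proof -
  note inv = matrix_inv_mult[OF assms]
  have entry: "(\<Sum>i\<in>UNIV. matrix_inv R $ a $ i * R $ i $ b) = (if a = b then 1 else 0)" for a b
    using arg_cong[OF inv(2), of "\<lambda>A. A $ a $ b"] by (simp add: matrix_matrix_mult_def mat_def)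
  show "left_I R ** block_I R = mat 1" "left_I R ** block_J R = 0"
    "left_J R ** block_I R = 0" "left_J R ** block_J R = mat 1"
    by (simp_all add: vec_eq_iff matrix_matrix_mult_def left_I_nth left_J_nth block_I_def[of R]
        block_J_def[of R] entry mat_def)
  have "(block_I R ** left_I R + block_J R ** left_J R) $ i $ j = (R ** matrix_inv R) $ i $ j" for i j
    by (simp add: matrix_matrix_mult_def left_I_nth left_J_nth block_I_def[of R]
        block_J_def[of R] sum_UNIV_Plus)
  then show "block_I R ** left_I R + block_J R ** left_J R = mat 1"
    by (simp add: vec_eq_iff inv(1))
qed

lemma Lam_I_eq: "Lam_I M R = left_I R ** M ** block_I R"
  and Lam_IJ_eq: "Lam_IJ M R = left_I R ** M ** block_J R"
  and Lam_J_eq: "Lam_J M R = left_J R ** M ** block_J R"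
  and similar_mat_lower: "similar_mat M R $ Inr l $ Inl k = (left_J R ** M ** block_I R) $ l $ k"
  by (simp_all add: vec_eq_iff Lam_I_def Lam_IJ_def Lam_J_def similar_mat_def
      matrix_matrix_mult_def left_I_nth left_J_nth block_I_def[of R] block_J_def[of R])

definition join :: "real^'q^'p \<Rightarrow> real^'j^'p \<Rightarrow> real^('q::finite + 'j::finite)^'p" where
  "join A B = (\<chi> i k. case k of Inl a \<Rightarrow> A $ i $ a | Inr b \<Rightarrow> B $ i $ b)"

lemma block_join [simp]: "block_I (join A B) = A" "block_J (join A B) = B"
  by (simp_all add: block_I_def block_J_def join_def vec_eq_iff)

text \<open>The block relations characterize an inverse, so that a change of one block of \<open>R\<close> never needs the
  matrix \<open>R\<^sup>-\<^sup>1\<close> to be computed.\<close>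

lemma join_invertible:
  fixes A :: "real^'q::finite^'p" and B :: "real^'j::finite^'p"
  assumes "C ** A = mat 1" "C ** B = 0" "D ** A = 0" "D ** B = mat 1" "A ** C + B ** D = mat 1"
  shows "invertible (join A B)" "left_I (join A B) = C" "left_J (join A B) = D"
proof -
  let ?R = "join A B"
  let ?X = "\<chi> k i. case k of Inl a \<Rightarrow> C $ a $ i | Inr b \<Rightarrow> D $ b $ i"
  have "?R ** ?X = A ** C + B ** D"
    by (simp add: vec_eq_iff matrix_matrix_mult_def sum_UNIV_Plus join_def)
  then have RX: "?R ** ?X = mat 1" using assms by simp
  have "(?X ** ?R) $ a $ b = mat 1 $ a $ b" for a b
  proof -
    have e: "(C ** A) $ i $ j = mat 1 $ i $ j" "(C ** B) $ i $ j' = 0"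
      "(D ** A) $ i' $ j = 0" "(D ** B) $ i' $ j' = mat 1 $ i' $ j'" for i j i' j'
      using assms by simp_all
    show ?thesis
      using e by (cases a; cases b) (simp_all add: matrix_matrix_mult_def join_def mat_def)
  qed
  then have XR: "?X ** ?R = mat 1" by (simp add: vec_eq_iff)
  show "invertible ?R" using RX XR invertible_def by blast
  have "matrix_inv ?R = ?X" by (rule matrix_inv_unique[OF RX XR])
  then show "left_I ?R = C" "left_J ?R = D"
    by (simp_all add: vec_eq_iff left_I_nth left_J_nth)
qed

definition modulus_gap :: "real^'q^'q \<Rightarrow> real^'j^'j \<Rightarrow> bool" where
  "modulus_gap A D \<longleftrightarrow> (\<forall>z\<in>spectrum A. \<forall>w\<in>spectrum D. cmod w < cmod z)"

lemma modulus_gap_disjoint: "modulus_gap A D \<Longrightarrow> spectrum A \<inter> spectrum D = {}"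
  unfolding modulus_gap_def by fastforce

lemma spectrum_cnj: "cnj ` spectrum A = spectrum A"
proof -
  have "cnj z \<in> spectrum A" if "z \<in> spectrum A" for z
  proof -
    from that obtain v where v: "v \<noteq> 0" "map_matrix complex_of_real A *v v = z *s v"
      by (auto simp: spectrum_def)
    define u where "u = (\<chi> i. cnj (v $ i))"
    have "(map_matrix complex_of_real A *v u) $ i = cnj z * u $ i" for i
      using arg_cong[OF v(2), of "\<lambda>x. cnj (x $ i)"] by (simp add: matrix_vector_mult_def u_def)
    moreover have "u \<noteq> 0" using v(1) by (auto simp: vec_eq_iff u_def)
    ultimately show ?thesis by (auto simp: spectrum_def vec_eq_iff)
  qed
  then show ?thesis by (force simp: image_iff intro: bexI[of _ "cnj _"])
qed

text \<open>For real matrices the spectra are closed under conjugation, and a strict gap between the moduli makes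
  them disjoint; what remains is the triangular form and the gap.\<close>

lemma spectral_split_iff:
  "spectral_split M R \<longleftrightarrow> invertible R \<and> left_J R ** M ** block_I R = 0 \<and>
     modulus_gap (left_I R ** M ** block_I R) (left_J R ** M ** block_J R)"
proof -
  have "(\<forall>i k. similar_mat M R $ Inr i $ Inl k = 0) \<longleftrightarrow> left_J R ** M ** block_I R = 0"
    by (simp add: similar_mat_lower vec_eq_iff)
  then show ?thesis
    using modulus_gap_disjoint[of "Lam_I M R" "Lam_J M R"]
    by (auto simp: spectral_split_def spectrum_cnj modulus_gap_def Lam_I_eq Lam_J_eq)
qed

lemma spectral_split_relations:
  assumes "spectral_split M R"
  shows "M ** block_I R = block_I R ** Lam_I M R" "left_J R ** M = Lam_J M R ** left_J R"
proof -
  note b = block_products[of R] and s = assms[unfolded spectral_split_iff]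
  have "M ** block_I R = (block_I R ** left_I R + block_J R ** left_J R) ** (M ** block_I R)"
    using b s by simp
  also have "\<dots> = block_I R ** Lam_I M R + block_J R ** (left_J R ** M ** block_I R)"
    by (simp add: mm_distribs Lam_I_eq matrix_mul_assoc)
  finally show "M ** block_I R = block_I R ** Lam_I M R" using s by simp
  have "left_J R ** M = (left_J R ** M) ** (block_I R ** left_I R + block_J R ** left_J R)"
    using b s by simp
  also have "\<dots> = (left_J R ** M ** block_I R) ** left_I R + Lam_J M R ** left_J R"
    by (simp add: mm_distribs Lam_J_eq matrix_mul_assoc)
  finally show "left_J R ** M = Lam_J M R ** left_J R" using s by simp
qed

lemma split_disjoint: "spectral_split M R \<Longrightarrow> spectrum (Lam_I M R) \<inter> spectrum (Lam_J M R) = {}"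
  by (simp add: spectral_split_def)

subsection \<open>Uniqueness of the dominant invariant subspace\<close>

text \<open>The orthogonality hypothesis says that \<open>block_I R'\<close> and \<open>block_I R\<close> span the same space. Then \<open>Q\<close> changes
  the basis of that space, and \<open>H\<close> that of its annihilator.\<close>

lemma same_span_change_of_basis:
  fixes R R' :: "real^('q::finite + 'j::finite)^'p"
  assumes R: "invertible R" and R': "invertible R'" and orth: "left_J R ** block_I R' = 0"
  defines "Q \<equiv> left_I R ** block_I R'" and "H \<equiv> left_J R' ** block_J R"
  shows "block_I R' = block_I R ** Q" "(left_I R' ** block_I R) ** Q = mat 1"
    "Q ** (left_I R' ** block_I R) = mat 1" "left_J R' ** block_I R = 0" "left_J R' = H ** left_J R"
proof -
  note b = block_products[OF R] and b' = block_products[OF R']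
  have "block_I R' = (block_I R ** left_I R + block_J R ** left_J R) ** block_I R'"
    by (simp add: b)
  also have "\<dots> = block_I R ** Q + block_J R ** (left_J R ** block_I R')"
    by (simp add: mm_distribs Q_def matrix_mul_assoc)
  finally show I: "block_I R' = block_I R ** Q" by (simp add: orth)
  show 1: "(left_I R' ** block_I R) ** Q = mat 1"
    using b'(1) I by (simp add: matrix_mul_assoc[symmetric])
  then show 2: "Q ** (left_I R' ** block_I R) = mat 1"
    using matrix_left_right_inverse by blast
  have "left_J R' ** block_I R = left_J R' ** (block_I R ** Q) ** (left_I R' ** block_I R)"
    using 2 by (metis matrix_mul_assoc matrix_mul_rid)
  then show 3: "left_J R' ** block_I R = 0" using I b'(3) by simp
  have "left_J R' = left_J R' ** (block_I R ** left_I R + block_J R ** left_J R)"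
    by (simp add: b)
  also have "\<dots> = left_J R' ** block_I R ** left_I R + H ** left_J R"
    by (simp add: mm_distribs H_def matrix_mul_assoc)
  finally show "left_J R' = H ** left_J R" by (simp add: 3)
qed

lemma split_orthogonal:
  fixes R R' :: "real^('q::finite + 'j::finite)^'p"
  assumes S: "spectral_split M R" and S': "spectral_split M R'"
    and disj: "spectrum (Lam_J M R) \<inter> spectrum (Lam_I M R') = {}"
  shows "left_J R ** block_I R' = 0"
proof (rule sylvester_kernel[OF _ disj])
  show "Lam_J M R ** (left_J R ** block_I R') = left_J R ** block_I R' ** Lam_I M R'"
    by (metis S S' matrix_mul_assoc spectral_split_relations)
qed

text \<open>If the block \<open>J\<close> of one split shares an eigenvalue with the block \<open>I\<close> of the other, the gaps
  force the remaining pair of blocks to have disjoint spectra, so that one of the two Sylvester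
  equations always has only the trivial solution.\<close>

lemma spectral_split_unique:
  fixes R R' :: "real^('q::finite + 'j::finite)^'p"
  assumes S: "spectral_split M R" and S': "spectral_split M R'"
  shows "left_J R ** block_I R' = 0"
proof (cases "spectrum (Lam_J M R') \<inter> spectrum (Lam_I M R) = {}")
  case True
  then have "left_J R' ** block_I R = 0" by (rule split_orthogonal[OF S' S])
  then show ?thesis
    using same_span_change_of_basis(4)[of R' R] S S' by (simp add: spectral_split_def)
next
  case False
  then obtain w where w: "w \<in> spectrum (Lam_J M R')" "w \<in> spectrum (Lam_I M R)" by blast
  have "cmod y < cmod z" if "y \<in> spectrum (Lam_J M R)" "z \<in> spectrum (Lam_I M R')" for y z
    using S S' w that unfolding spectral_split_def by (meson less_trans)
  then have "spectrum (Lam_J M R) \<inter> spectrum (Lam_I M R') = {}" by blast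
  then show ?thesis by (rule split_orthogonal[OF S S'])
qed

subsection \<open>Persistence of the gap\<close>

text \<open>At a unit eigenvector this is the eigenvalue, which makes the eigenvalue a continuous function of the
  matrix and the eigenvector.\<close>

definition rayleigh :: "complex^'n^'n \<Rightarrow> complex^'n \<Rightarrow> complex" where
  "rayleigh A v = (\<Sum>i\<in>UNIV. cnj (v $ i) * (A *v v) $ i)"

lemma rayleigh_eigenvector:
  assumes "A *v v = z *s v" "norm v = 1"
  shows "rayleigh A v = z"
proof -
  have "(\<Sum>i\<in>UNIV. cnj (v $ i) * v $ i) = complex_of_real ((norm v)\<^sup>2)"
    by (simp add: norm_vec_def L2_set_def sum_nonneg mult.commute[of "cnj _"]
        complex_norm_square[symmetric] del: of_real_power)
  moreover have "rayleigh A v = z * (\<Sum>i\<in>UNIV. cnj (v $ i) * v $ i)"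
    by (simp add: rayleigh_def assms(1) sum_distrib_left mult_ac)
  ultimately show ?thesis using assms(2) by simp
qed

lemma spectrum_unit_vector:
  "z \<in> spectrum A \<longleftrightarrow> (\<exists>v. norm v = 1 \<and> z = rayleigh (map_matrix complex_of_real A) v \<and>
     map_matrix complex_of_real A *v v = rayleigh (map_matrix complex_of_real A) v *s v)"
  (is "_ \<longleftrightarrow> ?R")
proof
  let ?A = "map_matrix complex_of_real A"
  assume "z \<in> spectrum A"
  then obtain v where v: "v \<noteq> 0" "?A *v v = z *s v" by (auto simp: spectrum_def)
  define u where "u = complex_of_real (inverse (norm v)) *s v"
  have "u = inverse (norm v) *\<^sub>R v"
    unfolding u_def vec_eq_iff vector_scaleR_component vector_smult_component
    by (simp add: scaleR_conv_of_real)
  then have "norm u = 1" using v(1) by simp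
  moreover have "?A *v u = z *s u"
    by (simp add: u_def vector_scalar_commute v(2) vector_smult_assoc mult.commute)
  ultimately show ?R using rayleigh_eigenvector by blast
next
  assume ?R
  then obtain v where v: "norm v = 1" "map_matrix complex_of_real A *v v = z *s v" by blast
  then have "v \<noteq> 0" by auto
  with v(2) show "z \<in> spectrum A" by (auto simp: spectrum_def)
qed

lemma continuous_on_rayleigh:
  fixes f :: "'a::topological_space \<Rightarrow> real^'n^'n" and g :: "'a \<Rightarrow> complex^'n"
  assumes "continuous_on S f" "continuous_on S g"
  shows "continuous_on S (\<lambda>x. rayleigh (map_matrix complex_of_real (f x)) (g x))"
  unfolding rayleigh_def matrix_vector_mult_def
  by (simp, intro continuous_intros continuous_on_component assms)

text \<open>Eigenvalues are read off unit eigenvectors, which range over a compact set, so the pairs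
  without a gap form a closed set.\<close>

lemma open_modulus_gap: "open {(A :: real^'q^'q, D :: real^'j^'j). modulus_gap A D}"
proof -
  let ?c = "map_matrix complex_of_real"
  let ?r = "\<lambda>A v. rayleigh (?c A) v"
  let ?K = "sphere 0 1 \<times> sphere 0 1 :: ((complex^'q) \<times> (complex^'j)) set"
  let ?T = "{((v, u), (A, D)). ?c A *v v = ?r A v *s v \<and> ?c D *v u = ?r D u *s u \<and>
      cmod (?r A v) \<le> cmod (?r D u)} :: (((complex^'q) \<times> (complex^'j)) \<times> ((real^'q^'q) \<times> (real^'j^'j))) set"
  have cont: "continuous_on UNIV (\<lambda>x. ?c (f x) *v g x)"
    if "continuous_on UNIV f" "continuous_on UNIV g"
    for f :: "(((complex^'q) \<times> (complex^'j)) \<times> ((real^'q^'q) \<times> (real^'j^'j))) \<Rightarrow> real^'n^'n" and g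
    unfolding matrix_vector_mult_def
    by (simp, intro continuous_intros continuous_on_component that)
  have cont2: "continuous_on UNIV (\<lambda>x. h x *s g x)"
    if "continuous_on UNIV h" "continuous_on UNIV g"
    for h :: "(((complex^'q) \<times> (complex^'j)) \<times> ((real^'q^'q) \<times> (real^'j^'j))) \<Rightarrow> complex"
      and g :: "_ \<Rightarrow> complex^'n"
    unfolding vector_scalar_mult_def
    by (intro continuous_intros continuous_on_component that)
  have "closed ?T"
    unfolding case_prod_beta
    by (intro closed_Collect_conj closed_Collect_eq closed_Collect_le cont cont2
        continuous_on_rayleigh continuous_intros)
  then have "closed {y. \<exists>x. x \<in> ?K \<and> (x, y) \<in> ?T}"
    by (intro closed_compact_projection compact_Times) auto
  also have "{y. \<exists>x. x \<in> ?K \<and> (x, y) \<in> ?T} = - {(A, D). modulus_gap A D}"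
  proof (rule set_eqI)
    fix y :: "(real^'q^'q) \<times> (real^'j^'j)"
    obtain A D where y: "y = (A, D)" by (cases y)
    have "y \<in> {y. \<exists>x. x \<in> ?K \<and> (x, y) \<in> ?T} \<longleftrightarrow> (\<exists>z\<in>spectrum A. \<exists>w\<in>spectrum D. cmod z \<le> cmod w)"
      unfolding Bex_def spectrum_unit_vector y by auto
    also have "\<dots> \<longleftrightarrow> y \<in> - {(A, D). modulus_gap A D}"
      by (auto simp: modulus_gap_def not_less y)
    finally show "y \<in> {y. \<exists>x. x \<in> ?K \<and> (x, y) \<in> ?T} \<longleftrightarrow> y \<in> - {(A, D). modulus_gap A D}" .
  qed
  finally show ?thesis by (simp add: closed_def)
qed

lemma eventually_modulus_gap:
  assumes "(f \<longlongrightarrow> A) F" "(g \<longlongrightarrow> D) F" "modulus_gap A D"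
  shows "\<forall>\<^sub>F x in F. modulus_gap (f x) (g x)"
  using topological_tendstoD[OF tendsto_Pair[OF assms(1,2)] open_modulus_gap] assms(3) by simp

section \<open>The Wald statistic in the basis of a reference split\<close>

text \<open>What remains of \<open>wald_B\<close> when the outer factor \<open>L\<^sub>I\<close> is split off. The blocks are separate arguments
  because they are going to be taken from different matrices.\<close>

definition wald_core ::
    "real^'m^'p \<Rightarrow> real^'j^'p \<Rightarrow> real^'q^'p \<Rightarrow> real^'p^'j \<Rightarrow> real^'q^'q \<Rightarrow> real^'j^'j \<Rightarrow>
     real^('p \<times> 'p)^('q \<times> 'm)" where
  "wald_core U RJ RI LJ A D =
     kron (mat 1) (transpose U ** RJ) ** matrix_inv (sylvester A D) ** kron (transpose RI) LJ"

lemma sylvester_inv_vec_mat: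
  fixes A :: "real^'q^'q" and D :: "real^'j^'j"
  assumes "invertible (sylvester A D)" "Y ** A - D ** Y = C"
  shows "matrix_inv (sylvester A D) *v vec_mat C = vec_mat Y"
proof -
  have "matrix_inv (sylvester A D) *v (sylvester A D *v vec_mat Y) = vec_mat Y"
    by (simp only: matrix_vector_mul_assoc matrix_inv_mult(2)[OF assms(1)] matrix_vector_mul_lid)
  then show ?thesis by (simp only: sylvester_vec_mat assms(2))
qed

lemma sylvester_solution:
  fixes A :: "real^'q^'q" and D :: "real^'j^'j"
  assumes "invertible (sylvester A D)"
  shows "unvec (matrix_inv (sylvester A D) *v vec_mat C) ** A -
      D ** unvec (matrix_inv (sylvester A D) *v vec_mat C) = C" (is "?Y ** A - D ** ?Y = C")
proof -
  have "sylvester A D *v vec_mat ?Y = vec_mat C"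
    by (simp only: vec_mat_unvec matrix_vector_mul_assoc matrix_inv_mult(1)[OF assms] matrix_vector_mul_lid)
  then show ?thesis by (simp only: sylvester_vec_mat vec_mat_eq_iff)
qed

text \<open>On stacked matrices, \<open>wald_core\<close> and \<open>wald_B\<close> solve a Sylvester equation.\<close>

lemma wald_core_apply:
  fixes U :: "real^'m^'p" and A :: "real^'q^'q" and D :: "real^'j^'j"
  assumes "invertible (sylvester A D)" "Y ** A - D ** Y = LJ ** X ** RI"
  shows "wald_core U RJ RI LJ A D *v vec_mat X = vec_mat (transpose U ** RJ ** Y)"
  by (simp add: wald_core_def matrix_vector_mul_assoc[symmetric] kron_vec_mat
      sylvester_inv_vec_mat[OF assms])

lemma wald_B_apply:
  assumes "invertible (sylvester (Lam_I M R) (Lam_J M R))"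
    "Y ** Lam_I M R - Lam_J M R ** Y = left_J R ** X ** block_I R"
  shows "wald_B U M R *v vec_mat X = vec_mat (transpose U ** block_J R ** Y ** left_I R)"
  unfolding wald_B_def sylvester_def[symmetric]
  by (simp add: matrix_vector_mul_assoc[symmetric] kron_vec_mat sylvester_inv_vec_mat[OF assms])

lemma split_invertible_sylvester:
  "spectral_split M R \<Longrightarrow> invertible (sylvester (Lam_I M R) (Lam_J M R))"
  by (intro invertible_sylvester split_disjoint)

text \<open>Two splits of the same matrix are compared: \<open>R\<close> is a reference, \<open>R'\<close> is arbitrary. The invariant
  subspaces agree, with changes of basis \<open>Q\<close> and \<open>H\<close>; but \<open>block_J R'\<close> may span another complement, and
  \<open>F\<close> is the component by which it leans towards the span of \<open>block_I R\<close>.\<close>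

context
  fixes M :: "real^'p^'p" and R R' :: "real^('q::finite + 'j::finite)^'p"
    and Q :: "real^'q^'q" and H :: "real^'j^'j" and F :: "real^'j^'q"
  assumes S: "spectral_split M R" and S': "spectral_split M R'"
    and Q: "Q = left_I R ** block_I R'" and H: "H = left_J R' ** block_J R"
    and F: "F = left_I R ** block_J R' ** H"
begin

lemma two_splits_invertible: "invertible R" "invertible R'"
  using S S' by (simp_all add: spectral_split_def)

lemmas two_splits_basis =
  same_span_change_of_basis[OF two_splits_invertible spectral_split_unique[OF S S'], folded Q H]

lemma two_splits_complement: "block_J R' ** H = block_J R + block_I R ** F"
proof -
  note b = block_products[OF two_splits_invertible(1)] and b' = block_products[OF two_splits_invertible(2)]
  have "block_J R' ** left_J R' = mat 1 - block_I R' ** left_I R'"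
    using b'(5) by (simp add: eq_diff_eq add.commute)
  then have "left_J R ** (block_J R' ** H) = left_J R ** (mat 1 - block_I R' ** left_I R') ** block_J R"
    unfolding H by (metis matrix_mul_assoc)
  also have "\<dots> = mat 1"
    by (simp add: mm_distribs b matrix_mul_assoc spectral_split_unique[OF S S'])
  finally have *: "left_J R ** (block_J R' ** H) = mat 1" .
  have "block_J R' ** H = (block_I R ** left_I R + block_J R ** left_J R) ** (block_J R' ** H)"
    by (simp add: b)
  also have "\<dots> = block_I R ** F + block_J R ** (left_J R ** (block_J R' ** H))"
    by (simp add: mm_distribs matrix_mul_assoc F)
  finally show ?thesis by (simp only: * matrix_mul_rid add.commute)
qed

lemma two_splits_left_I: "Q ** left_I R' ** block_I R = mat 1" "Q ** left_I R' = left_I R - F ** left_J R"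
proof -
  note b = block_products[OF two_splits_invertible(1)] and b' = block_products[OF two_splits_invertible(2)]
  show 1: "Q ** left_I R' ** block_I R = mat 1"
    using two_splits_basis(3) by (simp add: matrix_mul_assoc)
  have "Q ** left_I R' ** (block_J R' ** H) = 0"
    using b'(2) by (metis matrix_mul_assoc mm_zero_left mm_zero_right)
  then have "Q ** left_I R' ** block_J R + Q ** left_I R' ** block_I R ** F = 0"
    unfolding two_splits_complement by (simp add: mm_distribs matrix_mul_assoc)
  then have 2: "Q ** left_I R' ** block_J R = - F"
    unfolding 1 by (simp add: eq_neg_iff_add_eq_0)
  have "Q ** left_I R' = Q ** left_I R' ** (block_I R ** left_I R + block_J R ** left_J R)"
    by (simp add: b)
  also have "\<dots> = Q ** left_I R' ** block_I R ** left_I R + Q ** left_I R' ** block_J R ** left_J R"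
    by (simp only: mm_distribs matrix_mul_assoc)
  finally show "Q ** left_I R' = left_I R - F ** left_J R"
    unfolding 1 2 by (simp add: mm_distribs)
qed

text \<open>The coupling of \<open>R'\<close> determines \<open>F\<close> through a Sylvester equation. Hence a bound on the coupling is a
  bound on \<open>F\<close>.\<close>

lemma two_splits_coupling:
  "left_I R ** coupling M R' ** block_J R = Lam_IJ M R + Lam_I M R ** F - F ** Lam_J M R"
proof -
  have "left_I R ** coupling M R' ** block_J R = Q ** left_I R' ** M ** (block_J R' ** H)"
    by (simp only: coupling_def Lam_IJ_eq matrix_mul_assoc Q H)
  also have "\<dots> = (left_I R - F ** left_J R) ** M ** (block_J R + block_I R ** F)"
    by (simp only: two_splits_complement two_splits_left_I(2))
  also have "\<dots> = Lam_IJ M R + Lam_I M R ** F - F ** Lam_J M R - F ** (left_J R ** M ** block_I R) ** F"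
    by (simp only: mm_distribs Lam_I_eq Lam_IJ_eq Lam_J_eq matrix_mul_assoc) (simp add: algebra_simps)
  also have "left_J R ** M ** block_I R = 0"
    using S by (simp add: spectral_split_iff)
  finally show ?thesis by simp
qed

text \<open>If \<open>Y\<close> solves the Sylvester equation behind \<open>wald_B\<close> in the basis \<open>R\<close>, then \<open>H Y Q\<close> solves it in the
  basis \<open>R'\<close>. Apart from \<open>F\<close>, all of the dependence on \<open>R'\<close> is thereby moved into a left factor
  with a left inverse.\<close>

lemma two_splits_wald_B:
  fixes U :: "real^'m^'p"
  shows "wald_B U M R' = kron (transpose (Q ** left_I R')) (mat 1) **
    wald_core U (block_J R + block_I R ** F) (block_I R) (left_J R) (Lam_I M R) (Lam_J M R)"
proof (rule matrix_eq_on_vec_mat)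
  fix X
  let ?A = "Lam_I M R" and ?D = "Lam_J M R" and ?A' = "Lam_I M R'" and ?D' = "Lam_J M R'"
  note inv = split_invertible_sylvester[OF S] and inv' = split_invertible_sylvester[OF S']
  note b = block_products[OF two_splits_invertible(1)]
  obtain Y where Y: "Y ** ?A - ?D ** Y = left_J R ** X ** block_I R"
    using sylvester_solution[OF inv] by blast
  have "Q ** ?A' = left_I R ** (M ** block_I R')"
    by (simp add: spectral_split_relations[OF S'] matrix_mul_assoc Q)
  also have "\<dots> = left_I R ** (M ** (block_I R ** Q))"
    using two_splits_basis(1) by simp
  also have "\<dots> = ?A ** Q"
    by (simp add: Lam_I_eq matrix_mul_assoc)
  finally have QA: "Q ** ?A' = ?A ** Q" .
  have "?D' ** H = (left_J R' ** M) ** block_J R"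
    by (simp add: spectral_split_relations[OF S'] matrix_mul_assoc H)
  also have "\<dots> = (H ** left_J R) ** M ** block_J R"
    using two_splits_basis(5) by simp
  finally have DH: "?D' ** H = H ** ?D"
    by (simp add: Lam_J_eq matrix_mul_assoc)
  have "(H ** Y ** Q) ** ?A' - ?D' ** (H ** Y ** Q) = H ** Y ** (Q ** ?A') - (?D' ** H) ** Y ** Q"
    by (simp only: matrix_mul_assoc)
  also have "\<dots> = H ** (Y ** ?A - ?D ** Y) ** Q"
    unfolding QA DH by (simp only: mm_distribs matrix_mul_assoc)
  also have "\<dots> = (H ** left_J R) ** X ** (block_I R ** Q)"
    unfolding Y by (simp only: matrix_mul_assoc)
  also have "\<dots> = left_J R' ** X ** block_I R'"
    using two_splits_basis(1,5) by simp
  finally have "wald_B U M R' *v vec_mat X =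
      vec_mat (transpose U ** block_J R' ** (H ** Y ** Q) ** left_I R')"
    by (rule wald_B_apply[OF inv'])
  also have "\<dots> = vec_mat (transpose U ** (block_J R' ** H) ** Y ** (Q ** left_I R'))"
    by (simp only: matrix_mul_assoc)
  finally show "wald_B U M R' *v vec_mat X = kron (transpose (Q ** left_I R')) (mat 1) **
      wald_core U (block_J R + block_I R ** F) (block_I R) (left_J R) ?A ?D *v vec_mat X"
    unfolding two_splits_complement
    by (simp add: matrix_vector_mul_assoc[symmetric] wald_core_apply[OF inv Y] kron_vec_mat)
qed

end

text \<open>Cancelling \<open>L\<close> in \<open>A X A = A\<close> for \<open>A = L S L\<^sup>T\<close> leaves \<open>S (L\<^sup>T X L) S = S\<close>: although \<open>X\<close> is not unique, its
  compression to the range of \<open>L\<close> is \<open>S\<^sup>-\<^sup>1\<close>.\<close>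

lemma sandwich_generalized_inverse:
  fixes L :: "real^'k^'n" and S :: "real^'k^'k" and X :: "real^'n^'n" and N :: "real^'n^'k"
  assumes left_inverse: "N ** L = mat 1" and S: "invertible S"
    and ginv: "(L ** S ** transpose L) ** X ** (L ** S ** transpose L) = L ** S ** transpose L"
  shows "(L *v z) \<bullet> (X *v (L *v z)) = z \<bullet> (matrix_inv S *v z)"
proof -
  let ?W = "transpose L ** X ** L"
  have NL': "transpose L ** transpose N = mat 1"
    using left_inverse by (metis matrix_transpose_mul transpose_mat)
  have "N ** ((L ** S ** transpose L) ** X ** (L ** S ** transpose L)) ** transpose N =
      (N ** L) ** S ** ?W ** S ** (transpose L ** transpose N)"
    by (simp only: matrix_mul_assoc)
  moreover have "N ** (L ** S ** transpose L) ** transpose N = (N ** L) ** S ** (transpose L ** transpose N)"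
    by (simp only: matrix_mul_assoc)
  ultimately have SWS: "S ** ?W ** S = S"
    by (simp add: ginv left_inverse NL')
  have "?W = (matrix_inv S ** S) ** ?W ** (S ** matrix_inv S)"
    by (simp add: matrix_inv_mult[OF S])
  also have "\<dots> = matrix_inv S ** (S ** ?W ** S) ** matrix_inv S"
    by (simp only: matrix_mul_assoc)
  also have "\<dots> = matrix_inv S"
    unfolding SWS by (simp add: matrix_inv_mult[OF S])
  finally have "?W = matrix_inv S" .
  moreover have "(L *v z) \<bullet> (X *v (L *v z)) = z \<bullet> (?W *v z)"
    by (simp only: matrix_vector_mul_assoc[symmetric] inner_transpose_mv[of z "transpose L"] transpose_transpose)
  ultimately show ?thesis by simp
qed

text \<open>The singular matrix \<open>wald_cov\<close> and the vector \<open>proj_vec\<close> carry the same factor \<open>L\<close>, so the statistic is a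
  quadratic form with a proper inverse, in which \<open>R'\<close> occurs only through \<open>F\<close>.\<close>

lemma wald_stat_eq:
  fixes M :: "real^'p^'p" and R R' :: "real^('q::finite + 'j::finite)^'p" and U :: "real^'m^'p"
  assumes S: "spectral_split M R" and S': "spectral_split M R'"
    and ginv: "generalized_inverse (wald_cov U M R' \<Omega>) X"
  defines "F \<equiv> left_I R ** block_J R' ** (left_J R' ** block_J R)"
  defines "C \<equiv> wald_core U (block_J R + block_I R ** F) (block_I R) (left_J R) (Lam_I M R) (Lam_J M R)"
  defines "z \<equiv> vec_mat (transpose U ** block_I R)"
  assumes inv: "invertible (C ** \<Omega> ** transpose C)"
  shows "wald_stat T U R' X = real T * (z \<bullet> (matrix_inv (C ** \<Omega> ** transpose C) *v z))"
proof -
  define V where "V = left_I R ** block_I R' ** left_I R'"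
  define L :: "real^('q \<times> 'm)^('p \<times> 'm)" where "L = kron (transpose V) (mat 1)"
  define N :: "real^('p \<times> 'm)^('q \<times> 'm)" where "N = kron (transpose (block_I R)) (mat 1)"
  have "transpose (block_I R) ** transpose V = transpose (V ** block_I R)"
    by (simp add: matrix_transpose_mul)
  also have "V ** block_I R = mat 1"
    unfolding V_def by (rule two_splits_left_I(1)[OF S S' refl refl refl])
  finally have NL: "N ** L = mat 1"
    by (simp add: N_def L_def kron_mult)
  have "wald_B U M R' = L ** C"
    unfolding L_def C_def V_def F_def by (rule two_splits_wald_B[OF S S' refl refl refl])
  then have cov: "wald_cov U M R' \<Omega> = L ** (C ** \<Omega> ** transpose C) ** transpose L"
    by (simp add: wald_cov_def matrix_transpose_mul matrix_mul_assoc)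
  have "transpose U ** block_I R' ** left_I R' = transpose U ** block_I R ** V"
    using two_splits_basis(1)[OF S S' refl refl] unfolding V_def by (metis matrix_mul_assoc)
  then have "proj_vec U R' = L *v z"
    by (simp add: proj_vec_def L_def z_def kron_vec_mat)
  then show ?thesis
    using ginv unfolding wald_stat_def generalized_inverse_def cov
    by (simp add: sandwich_generalized_inverse[OF NL inv])
qed

section \<open>Perturbation of a spectral split\<close>

text \<open>The columns of \<open>R\<^sub>I + R\<^sub>J Z\<close> span an invariant subspace of \<open>M'\<close> iff this vanishes.\<close>

definition riccati :: "real^('q::finite + 'j::finite)^'p \<Rightarrow> real^'p^'p \<Rightarrow> real^'q^'j \<Rightarrow> real^'q^'j" where
  "riccati R M' Z = (left_J R - Z ** left_I R) ** M' ** (block_I R + block_J R ** Z)"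

text \<open>The basis in which only the first block has been moved, by \<open>Z\<close>; it is the reference split for a
  perturbed matrix.\<close>

definition tilt :: "real^('q::finite + 'j::finite)^'p \<Rightarrow> real^'q^'j \<Rightarrow> real^('q + 'j)^'p" where
  "tilt R Z = join (block_I R + block_J R ** Z) (block_J R)"

lemma tilt_blocks [simp]: "block_I (tilt R Z) = block_I R + block_J R ** Z" "block_J (tilt R Z) = block_J R"
  by (simp_all add: tilt_def)

lemma tilt_left:
  assumes "invertible R"
  shows "invertible (tilt R Z)" "left_I (tilt R Z) = left_I R" "left_J (tilt R Z) = left_J R - Z ** left_I R"
proof -
  note b = block_products[OF assms]
  have "(block_I R + block_J R ** Z) ** left_I R + block_J R ** (left_J R - Z ** left_I R) = mat 1"
    using b(5) by (simp add: mm_distribs matrix_mul_assoc)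
  moreover have "left_I R ** (block_I R + block_J R ** Z) = mat 1"
    "(left_J R - Z ** left_I R) ** (block_I R + block_J R ** Z) = 0"
    "(left_J R - Z ** left_I R) ** block_J R = mat 1"
    by (simp_all add: mm_distribs matrix_mul_assoc b)
      (simp_all add: matrix_mul_assoc[symmetric] b)
  ultimately show "invertible (tilt R Z)" "left_I (tilt R Z) = left_I R"
    "left_J (tilt R Z) = left_J R - Z ** left_I R"
    unfolding tilt_def using join_invertible b(2) by blast+
qed

lemma bounded_linear_unvec: "bounded_linear (unvec :: real^('n \<times> 'm) \<Rightarrow> real^'n^'m)"
  by (intro linear_conv_bounded_linear[THEN iffD1] linearI) (auto simp: unvec_def vec_eq_iff)

text \<open>The derivative of the equation in \<open>Z\<close> at \<open>(M, 0)\<close> is a Sylvester operator, hence invertible, so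
  the equation can be solved near \<open>(M, 0)\<close> by the open mapping property of submersions.\<close>

lemma ex_small_riccati_solution:
  fixes M :: "real^'p^'p" and R :: "real^('q::finite + 'j::finite)^'p"
  assumes S: "spectral_split M R" and r: "r > 0"
  shows "\<forall>\<^sub>F M' in nhds M. \<exists>Z. norm Z < r \<and> riccati R M' Z = 0"
proof -
  let ?K = "sylvester (Lam_I M R) (Lam_J M R)"
  let ?f = "\<lambda>x. (fst x, riccati R (fst x) (snd x))"
  let ?f' = "\<lambda>h. (fst h, left_J R ** fst h ** block_I R -
      (snd h ** Lam_I M R - Lam_J M R ** snd h))"
  let ?g' = "\<lambda>h. (fst h, unvec (matrix_inv ?K *v vec_mat (left_J R ** fst h ** block_I R - snd h)))"
  let ?T = "UNIV \<times> ball 0 r :: ((real^'p^'p) \<times> (real^'q^'j)) set"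
  note inv = split_invertible_sylvester[OF S]
  note b = block_products[OF S[unfolded spectral_split_def, THEN conjunct1]]
  note fd = bounded_bilinear.FDERIV[OF bounded_bilinear_matrix_matrix]
  have lo: "left_J R ** M ** block_I R = 0"
    using S by (simp add: spectral_split_iff)
  have d: "((\<lambda>x :: (real^'p^'p) \<times> (real^'q^'j). riccati R (fst x) (snd x)) has_derivative (\<lambda>h. snd (?f' h))) (at (M, 0))"
    unfolding riccati_def
    by (rule has_derivative_eq_rhs, (rule fd derivative_intros)+)
      (simp add: fun_eq_iff mm_distribs Lam_I_eq Lam_J_eq matrix_mul_assoc)
  have "?f (M, 0) \<in> interior (?f ` ?T)"
  proof (rule sussmann_open_mapping[OF open_UNIV])
    show "continuous_on UNIV ?f"
      unfolding riccati_def by (intro continuous_intros)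
    show "(?f has_derivative ?f') (at (M, 0))"
      using has_derivative_Pair[OF has_derivative_fst[OF has_derivative_ident] d] by simp
    have "bounded_linear (\<lambda>h :: (real^'p^'p) \<times> (real^'q^'j). left_J R ** fst h ** block_I R - snd h)"
      by (intro bounded_linear_sub bounded_linear_snd bounded_linear_fst
          bounded_linear_compose[OF bounded_bilinear.bounded_linear_left[OF bounded_bilinear_matrix_matrix]]
          bounded_linear_compose[OF bounded_bilinear.bounded_linear_right[OF bounded_bilinear_matrix_matrix]])
    from bounded_linear_compose[OF bounded_linear_unvec bounded_linear_compose[OF
        matrix_vector_mul_bounded_linear bounded_linear_compose[OF bounded_linear_vec_mat this]]]
    show "bounded_linear ?g'"
      by (rule bounded_linear_Pair[OF bounded_linear_fst])
    show "?f' \<circ> ?g' = id"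
      by (auto simp: fun_eq_iff sylvester_solution[OF inv])
    have "open ?T" by (intro open_Times) auto
    then show "(M, 0) \<in> interior ?T" using r by (simp add: interior_open)
  qed auto
  then have "(M, 0) \<in> interior (?f ` ?T)"
    by (simp add: riccati_def lo)
  then have "\<forall>\<^sub>F M' in nhds M. (M', 0) \<in> interior (?f ` ?T)"
    by (intro topological_tendstoD[of _ "(M, 0)"] tendsto_intros filterlim_ident open_interior)
  then show ?thesis
  proof eventually_elim
    case (elim M')
    then have "(M', 0) \<in> ?f ` ?T" using interior_subset by blast
    then show ?case by auto
  qed
qed

text \<open>Solutions of least norm tend to \<open>0\<close>.\<close>

lemma ex_riccati_branch:
  fixes M :: "real^'p^'p" and R :: "real^('q::finite + 'j::finite)^'p"
  assumes S: "spectral_split M R"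
  obtains \<zeta> where "(\<zeta> \<longlongrightarrow> 0) (nhds M)" "\<forall>\<^sub>F M' in nhds M. riccati R M' (\<zeta> M') = 0"
proof
  define Sol where "Sol M' = {Z. riccati R M' Z = 0}" for M'
  define \<zeta> where "\<zeta> M' = closest_point (Sol M') 0" for M'
  have closed: "closed (Sol M')" for M'
    unfolding Sol_def riccati_def by (intro closed_Collect_eq continuous_intros)
  have sol: "riccati R M' (\<zeta> M') = 0" if "riccati R M' Z = 0" for M' Z
    using closest_point_in_set[OF closed, of M' 0] that unfolding \<zeta>_def Sol_def by blast
  have le: "norm (\<zeta> M') \<le> norm Z" if "riccati R M' Z = 0" for M' Z
    using closest_point_le[OF closed, of Z M' 0] that by (simp add: \<zeta>_def Sol_def)
  show "\<forall>\<^sub>F M' in nhds M. riccati R M' (\<zeta> M') = 0"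
    using ex_small_riccati_solution[OF S zero_less_one] by eventually_elim (use sol in blast)
  show "(\<zeta> \<longlongrightarrow> 0) (nhds M)"
  proof (rule tendstoI)
    fix e :: real assume "e > 0"
    from ex_small_riccati_solution[OF S this] show "\<forall>\<^sub>F M' in nhds M. dist (\<zeta> M') 0 < e"
      by eventually_elim (use le in fastforce)
  qed
qed

lemma eventually_norm_le: "(f \<longlongrightarrow> a) F \<Longrightarrow> \<forall>\<^sub>F x in F. norm (f x) \<le> norm a + 1"
  using order_tendstoD(2)[OF tendsto_norm, of f a F "norm a + 1"] by (auto elim: eventually_mono)

text \<open>For \<open>M' = M + E\<close> the block equation \<open>Z A - D Z = L\<^sub>J\<^sup>T E R\<^sub>I\<close> with
  \<open>A = L\<^sub>I\<^sup>T M' (R\<^sub>I + R\<^sub>J Z)\<close> and \<open>D = L\<^sub>J\<^sup>T M' R\<^sub>J\<close> is exact, not just a linearization.\<close>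

lemma riccati_sylvester:
  assumes S: "spectral_split M R" and "riccati R M' Z = 0"
  shows "Z ** (left_I R ** M' ** (block_I R + block_J R ** Z)) - (left_J R ** M' ** block_J R) ** Z =
    left_J R ** (M' - M) ** block_I R"
proof -
  have "left_J R ** M ** block_I R = 0"
    using S by (simp add: spectral_split_iff)
  with assms(2) show ?thesis
    unfolding riccati_def by (simp add: mm_distribs matrix_mul_assoc algebra_simps)
qed

text \<open>The derivative of \<open>vec (U\<^sup>T R\<^sub>I)\<close>, for the tilted basis, with respect to the matrix that is split.\<close>

definition wald_jacobian :: "real^'m^'p \<Rightarrow> real^'p^'p \<Rightarrow> real^('q::finite + 'j::finite)^'p \<Rightarrow>
    real^('p \<times> 'p)^('q \<times> 'm)" where
  "wald_jacobian U M R = wald_core U (block_J R) (block_I R) (left_J R) (Lam_I M R) (Lam_J M R)"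

definition wald_form :: "real^'n^'k \<Rightarrow> real^'n^'n \<Rightarrow> real^'n \<Rightarrow> real" where
  "wald_form C \<Omega> x = (C *v x) \<bullet> (matrix_inv (C ** \<Omega> ** transpose C) *v (C *v x))"

lemma tendsto_wald_core:
  fixes A :: "real^'q^'q" and D :: "real^'j^'j"
  assumes "((\<lambda>x. transpose U ** rj x) \<longlongrightarrow> transpose U ** RJ) F" "(ri \<longlongrightarrow> RI) F" "(lj \<longlongrightarrow> LJ) F"
    "(a \<longlongrightarrow> A) F" "(d \<longlongrightarrow> D) F" "invertible (sylvester A D)"
  shows "((\<lambda>x. wald_core U (rj x) (ri x) (lj x) (a x) (d x)) \<longlongrightarrow> wald_core U RJ RI LJ A D) F"
  unfolding wald_core_def by (intro tendsto_intros tendsto_matrix_inv assms)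

text \<open>After scaling by \<open>\<surd>T\<close>, the exact block equation writes the statistic as a quadratic form in
  \<open>x = \<surd>T vec (M' - M)\<close> whose matrix converges. The tilt of the complement by a bounded \<open>F\<close> enters only
  through \<open>U\<^sup>T R\<^sub>J Z F\<close>, because \<open>U\<^sup>T R\<^sub>I = 0\<close>, and vanishes with \<open>Z\<close>.\<close>

lemma wald_stat_approximation:
  fixes M :: "real^'p^'p" and R :: "real^('q::finite + 'j::finite)^'p" and U :: "real^'m^'p"
    and \<Omega> :: "real^('p \<times> 'p)^('p \<times> 'p)"
    and R' :: "nat \<Rightarrow> real^('q + 'j)^'p" and T :: "nat \<Rightarrow> nat"
  defines "C \<equiv> wald_jacobian U M R"
  assumes S: "spectral_split M R" and null: "transpose U ** block_I R = 0"
    and inv: "invertible (C ** \<Omega> ** transpose C)"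
    and M': "M' \<longlonglongrightarrow> M" and \<Omega>': "\<Omega>' \<longlonglongrightarrow> \<Omega>"
    and bound: "\<And>k. norm (sqrt (real (T k)) *\<^sub>R vec_mat (M' k - M)) \<le> K"
    and coupling: "\<And>k. norm (coupling (M' k) (R' k)) \<le> K"
    and split: "\<And>k. (\<exists>R'' :: real^('q + 'j)^'p. spectral_split (M' k) R'') \<Longrightarrow> spectral_split (M' k) (R' k)"
    and ginv: "\<And>k. generalized_inverse (wald_cov U (M' k) (R' k) (\<Omega>' k)) (X k)"
  shows "(\<lambda>k. wald_stat (T k) U (R' k) (X k) - wald_form C \<Omega> (sqrt (real (T k)) *\<^sub>R vec_mat (M' k - M))) \<longlonglongrightarrow> 0"
proof -
  have R: "invertible R" using S by (simp add: spectral_split_def)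
  note b = block_products[OF R] and syl = split_invertible_sylvester[OF S]
  obtain \<zeta> where "(\<zeta> \<longlongrightarrow> 0) (nhds M)" "\<forall>\<^sub>F M' in nhds M. riccati R M' (\<zeta> M') = 0"
    by (rule ex_riccati_branch[OF S])
  define Z where "Z k = \<zeta> (M' k)" for k
  define Rt where "Rt k = tilt R (Z k)" for k
  have Z: "Z \<longlonglongrightarrow> 0" and ric: "\<forall>\<^sub>F k in sequentially. riccati R (M' k) (Z k) = 0"
    unfolding Z_def using \<open>(\<zeta> \<longlongrightarrow> 0) (nhds M)\<close> \<open>\<forall>\<^sub>F M' in nhds M. riccati R M' (\<zeta> M') = 0\<close> M'
    by (auto intro: filterlim_compose eventually_compose_filterlim)
  define A D D2 where "A k = left_I R ** M' k ** (block_I R + block_J R ** Z k)"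
    and "D k = (left_J R - Z k ** left_I R) ** M' k ** block_J R"
    and "D2 k = left_J R ** M' k ** block_J R" for k
  have RI: "(\<lambda>k. block_I R + block_J R ** Z k) \<longlonglongrightarrow> block_I R"
    and LJ: "(\<lambda>k. left_J R - Z k ** left_I R) \<longlonglongrightarrow> left_J R"
    using tendsto_add[OF tendsto_const tendsto_mm[OF tendsto_const Z], of "block_I R" "block_J R"]
      tendsto_diff[OF tendsto_const tendsto_mm[OF Z tendsto_const], of "left_J R" "left_I R"] by simp_all
  have A: "A \<longlonglongrightarrow> Lam_I M R" and D: "D \<longlonglongrightarrow> Lam_J M R" and D2: "D2 \<longlonglongrightarrow> Lam_J M R"
    unfolding A_def D_def D2_def Lam_I_eq Lam_J_eq by (intro tendsto_intros M' RI LJ)+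
  have Lam: "Lam_I (M' k) (Rt k) = A k" "Lam_J (M' k) (Rt k) = D k" for k
    by (simp_all add: Lam_I_eq Lam_J_eq Rt_def tilt_left[OF R] A_def D_def)
  have "\<forall>\<^sub>F k in sequentially. modulus_gap (A k) (D k)"
    using A D by (rule eventually_modulus_gap) (use S in \<open>simp add: spectral_split_iff Lam_I_eq Lam_J_eq\<close>)
  with ric have St: "\<forall>\<^sub>F k in sequentially. spectral_split (M' k) (Rt k)"
    by eventually_elim
      (simp add: spectral_split_iff Rt_def tilt_left[OF R] riccati_def A_def D_def)
  define F where "F k = left_I R ** block_J (R' k) ** (left_J (R' k) ** block_J R)" for k

  \<comment> \<open>\<open>F\<close> measures how far the complement in \<open>R' k\<close> is from that in \<open>R\<close>; it need not converge.\<close>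
  have "\<forall>\<^sub>F k in sequentially. invertible (sylvester (D k) (A k))"
    using St by eventually_elim
      (metis Lam inf_commute invertible_sylvester split_disjoint)
  then have "\<forall>\<^sub>F k in sequentially. vec_mat (F k) = matrix_inv (sylvester (D k) (A k)) *v
      vec_mat (Lam_IJ (M' k) (Rt k) - left_I R ** coupling (M' k) (R' k) ** block_J R)"
    using St
  proof eventually_elim
    case (elim k)
    have "spectral_split (M' k) (R' k)" using elim(2) split by blast
    from two_splits_coupling[OF elim(2) this refl refl refl]
    have "left_I R ** coupling (M' k) (R' k) ** block_J R = Lam_IJ (M' k) (Rt k) + A k ** F k - F k ** D k"
      by (simp add: Rt_def tilt_left[OF R] F_def Lam[unfolded Rt_def])
    then have "F k ** D k - A k ** F k =
        Lam_IJ (M' k) (Rt k) - left_I R ** coupling (M' k) (R' k) ** block_J R"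
      by (simp add: algebra_simps)
    from sylvester_inv_vec_mat[OF elim(1) this] show ?case by simp
  qed
  moreover
  have "invertible (sylvester (Lam_J M R) (Lam_I M R))"
    using split_disjoint[OF S] by (intro invertible_sylvester) blast
  then have "(\<lambda>k. matrix_inv (sylvester (D k) (A k))) \<longlonglongrightarrow> matrix_inv (sylvester (Lam_J M R) (Lam_I M R))"
    by (intro tendsto_matrix_inv tendsto_intros A D)
  then obtain c1 where "\<forall>\<^sub>F k in sequentially. norm (matrix_inv (sylvester (D k) (A k))) \<le> c1"
    using eventually_norm_le by blast
  moreover
  have "(\<lambda>k. Lam_IJ (M' k) (Rt k)) \<longlonglongrightarrow> Lam_IJ M R"
    unfolding Lam_IJ_eq by (simp add: Rt_def tilt_left[OF R]) (intro tendsto_intros M')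
  then obtain c2 where "\<forall>\<^sub>F k in sequentially. norm (Lam_IJ (M' k) (Rt k)) \<le> c2"
    using eventually_norm_le by blast
  ultimately have F: "\<forall>\<^sub>F k in sequentially. norm (F k) \<le> c1 * (c2 + norm (left_I R) * K * norm (block_J R))"
  proof eventually_elim
    case (elim k)
    have "norm (left_I R ** coupling (M' k) (R' k) ** block_J R) \<le> norm (left_I R) * K * norm (block_J R)"
      by (intro order_trans[OF norm_matrix_matrix_le] mult_right_mono
          order_trans[OF norm_matrix_matrix_le] mult_left_mono coupling) auto
    then have "norm (Lam_IJ (M' k) (Rt k) - left_I R ** coupling (M' k) (R' k) ** block_J R) \<le>
        c2 + norm (left_I R) * K * norm (block_J R)"
      using elim(3) norm_triangle_ineq4[of "Lam_IJ (M' k) (Rt k)" "left_I R ** coupling (M' k) (R' k) ** block_J R"]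
      by linarith
    then have "norm (matrix_inv (sylvester (D k) (A k))) *
        norm (Lam_IJ (M' k) (Rt k) - left_I R ** coupling (M' k) (R' k) ** block_J R) \<le>
        c1 * (c2 + norm (left_I R) * K * norm (block_J R))"
      using elim(2) order_trans[OF norm_ge_zero elim(2)] by (intro mult_mono) simp_all
    then show ?case
      unfolding norm_vec_mat[of "F k", symmetric] elim(1)
      by (intro order_trans[OF norm_matrix_vector_le]) (simp add: norm_vec_mat)
  qed
  have ZF: "(\<lambda>k. Z k ** F k) \<longlonglongrightarrow> 0"
  proof (rule Lim_null_comparison)
    show "\<forall>\<^sub>F k in sequentially. norm (Z k ** F k) \<le>
        norm (Z k) * (c1 * (c2 + norm (left_I R) * K * norm (block_J R)))"
      using F by eventually_elim (intro order_trans[OF norm_matrix_matrix_le] mult_left_mono, auto)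
    show "(\<lambda>k. norm (Z k) * (c1 * (c2 + norm (left_I R) * K * norm (block_J R)))) \<longlonglongrightarrow> 0"
      using tendsto_mult_right[OF tendsto_norm[OF Z]] by simp
  qed
  define C1 C2 where
    "C1 k = wald_core U (block_J R + (block_I R + block_J R ** Z k) ** F k) (block_I R + block_J R ** Z k)
      (left_J R - Z k ** left_I R) (A k) (D k)"
    and "C2 k = wald_core U (block_J R) (block_I R) (left_J R) (A k) (D2 k)" for k
  have "transpose U ** (block_J R + (block_I R + block_J R ** Z k) ** F k) =
      transpose U ** (block_J R + block_J R ** (Z k ** F k))" for k
    by (simp add: mm_distribs matrix_mul_assoc null)
  moreover have "(\<lambda>k. transpose U ** (block_J R + block_J R ** (Z k ** F k))) \<longlonglongrightarrow>
      transpose U ** (block_J R + block_J R ** 0)"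
    by (intro tendsto_intros ZF)
  ultimately have C1: "C1 \<longlonglongrightarrow> C" and C2: "C2 \<longlonglongrightarrow> C"
    unfolding C1_def C2_def C_def wald_jacobian_def
    by (auto intro!: tendsto_wald_core RI LJ A D D2 syl)
  have "(\<lambda>k. C1 k ** \<Omega>' k ** transpose (C1 k)) \<longlonglongrightarrow> C ** \<Omega> ** transpose C"
    by (intro tendsto_intros C1 \<Omega>')
  note inv_S = eventually_invertible[OF this inv] and lim_S = tendsto_matrix_inv[OF this inv]

  \<comment> \<open>Both sides are quadratic forms in the bounded vector \<open>x k\<close>, with converging matrices.\<close>
  define B B0 where
    "B k = transpose (C2 k) ** matrix_inv (C1 k ** \<Omega>' k ** transpose (C1 k)) ** C2 k"
    and "B0 = transpose C ** matrix_inv (C ** \<Omega> ** transpose C) ** C" for k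
  define x where "x k = sqrt (real (T k)) *\<^sub>R vec_mat (M' k - M)" for k
  have B: "B \<longlonglongrightarrow> B0"
    unfolding B_def B0_def by (intro tendsto_intros C2 lim_S)
  have form0: "wald_form C \<Omega> y = y \<bullet> (B0 *v y)" for y
    unfolding wald_form_def B0_def
    by (simp add: matrix_vector_mul_assoc[symmetric] inner_transpose_mv transpose_transpose)
  have "\<forall>\<^sub>F k in sequentially. invertible (sylvester (A k) (D2 k))"
    by (rule eventually_invertible[OF _ syl]) (intro tendsto_intros A D2)
  then have "\<forall>\<^sub>F k in sequentially. wald_stat (T k) U (R' k) (X k) = x k \<bullet> (B k *v x k)"
    using ric St inv_S
  proof eventually_elim
    case (elim k)
    have "spectral_split (M' k) (R' k)" using elim(3) split by blast
    note eq = wald_stat_eq[OF elim(3) this ginv, of "T k"]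
    have "vec_mat (transpose U ** (block_I R + block_J R ** Z k)) = vec_mat (transpose U ** block_J R ** Z k)"
      by (simp add: mm_distribs null matrix_mul_assoc)
    also have "\<dots> = C2 k *v vec_mat (M' k - M)"
      unfolding C2_def
      by (rule wald_core_apply[OF elim(1), symmetric])
        (use riccati_sylvester[OF S elim(2)] in \<open>simp add: A_def D2_def\<close>)
    finally have z: "vec_mat (transpose U ** (block_I R + block_J R ** Z k)) = C2 k *v vec_mat (M' k - M)" .
    have "wald_stat (T k) U (R' k) (X k) = real (T k) * ((C2 k *v vec_mat (M' k - M)) \<bullet>
        (matrix_inv (C1 k ** \<Omega>' k ** transpose (C1 k)) *v (C2 k *v vec_mat (M' k - M))))"
      using eq elim(4) by (simp add: Rt_def tilt_left[OF R] Lam[unfolded Rt_def] z C1_def F_def)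
    also have "\<dots> = real (T k) * (vec_mat (M' k - M) \<bullet> (B k *v vec_mat (M' k - M)))"
      unfolding B_def by (simp add: matrix_vector_mul_assoc[symmetric] inner_transpose_mv transpose_transpose)
    finally show ?case
      by (simp add: x_def matrix_vector_mult_scaleR mult.assoc[symmetric])
  qed
  then have "\<forall>\<^sub>F k in sequentially. norm (wald_stat (T k) U (R' k) (X k) - wald_form C \<Omega> (x k)) \<le>
      K * (norm (B k - B0) * K)"
  proof eventually_elim
    case (elim k)
    have x: "norm (x k) \<le> K" using bound[of k] by (simp add: x_def)
    have "wald_stat (T k) U (R' k) (X k) - wald_form C \<Omega> (x k) = x k \<bullet> ((B k - B0) *v x k)"
      by (simp add: elim form0 matrix_vector_mult_diff_rdistrib inner_diff_right)
    also have "norm \<dots> \<le> norm (x k) * (norm (B k - B0) * norm (x k))"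
      unfolding real_norm_def
      by (intro order_trans[OF Cauchy_Schwarz_ineq2] mult_left_mono norm_matrix_vector_le) auto
    also have "\<dots> \<le> K * (norm (B k - B0) * K)"
      using x order_trans[OF norm_ge_zero x] by (intro mult_mono) auto
    finally show ?case .
  qed
  moreover have "(\<lambda>k. K * (norm (B k - B0) * K)) \<longlonglongrightarrow> K * (norm (B0 - B0) * K)"
    by (intro tendsto_intros B)
  then have "(\<lambda>k. K * (norm (B k - B0) * K)) \<longlonglongrightarrow> 0" by simp
  ultimately show ?thesis
    unfolding x_def by (rule Lim_null_comparison)
qed

section \<open>Linear changes of variables\<close>

definition vec_of :: "('n \<Rightarrow> real) \<Rightarrow> real^'n" where
  "vec_of \<omega> = (\<chi> i. \<omega> i)"

lemma measurable_vec_of [measurable]: "vec_of \<in> (\<Pi>\<^sub>M i\<in>UNIV. borel) \<rightarrow>\<^sub>M borel"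
  by (subst borel_measurable_euclidean_space) (auto simp: vec_of_def Basis_vec_def inner_axis)

lemma measurable_vec_of_lborel [measurable]: "vec_of \<in> (\<Pi>\<^sub>M i\<in>UNIV. (lborel :: real measure)) \<rightarrow>\<^sub>M borel"
  by (subst measurable_cong_sets[OF sets_PiM_cong[OF refl sets_lborel] refl]) (rule measurable_vec_of)

lemma prod_Basis_cart: "(\<Prod>b\<in>Basis. f b) = (\<Prod>i\<in>UNIV. f (axis i 1 :: real^'n))"
proof -
  have eq: "Basis = (\<lambda>i. axis i 1 :: real^'n) ` UNIV"
    by (auto simp: Basis_vec_def)
  have "inj (\<lambda>i. axis i 1 :: real^'n)"
    by (auto simp: inj_on_def axis_eq_axis)
  from prod.reindex[OF this, of f] show ?thesis
    by (simp only: eq comp_def)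
qed

lemma lborel_vec_of: "lborel = distr (\<Pi>\<^sub>M i\<in>(UNIV :: 'n::finite set). lborel) borel vec_of"
proof (rule lborel_eqI)
  interpret product_sigma_finite "\<lambda>_ :: 'n. lborel :: real measure" by standard
  fix l u :: "real^'n"
  assume lu: "\<And>b. b \<in> Basis \<Longrightarrow> l \<bullet> b \<le> u \<bullet> b"
  have le: "l $ i \<le> u $ i" for i
    using lu[of "axis i 1"] by (simp add: inner_axis)
  have "vec_of -` box l u \<inter> space (\<Pi>\<^sub>M i\<in>(UNIV :: 'n set). (lborel :: real measure)) =
      (\<Pi>\<^sub>E i\<in>UNIV. {l $ i <..< u $ i})"
    by (auto simp: mem_box_cart vec_of_def space_PiM PiE_iff)
  then have "emeasure (distr (\<Pi>\<^sub>M i\<in>(UNIV :: 'n set). (lborel :: real measure)) borel vec_of) (box l u) =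
      (\<Prod>i\<in>UNIV. emeasure lborel {l $ i <..< u $ i})"
    by (simp add: emeasure_distr emeasure_PiM)
  also have "\<dots> = ennreal (\<Prod>b\<in>Basis. (u - l) \<bullet> b)"
    by (simp add: le prod_ennreal prod_Basis_cart inner_axis)
  finally show "emeasure (distr (\<Pi>\<^sub>M i\<in>(UNIV :: 'n set). (lborel :: real measure)) borel vec_of) (box l u) =
      (\<Prod>b\<in>Basis. (u - l) \<bullet> b)" .
qed simp

text \<open>Integrating over coordinate \<open>m\<close> first, with the other coordinates held fixed, turns the shear into a
  translation of the line.\<close>

lemma nn_integral_shear:
  fixes g :: "real^'n \<Rightarrow> ennreal"
  assumes mn: "m \<noteq> n" and g [measurable]: "g \<in> borel_measurable borel"
  shows "(\<integral>\<^sup>+x. g (\<chi> i. if i = m then x $ m + x $ n else x $ i) \<partial>lborel) = (\<integral>\<^sup>+x. g x \<partial>lborel)"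
proof -
  let ?h = "\<lambda>x :: real^'n. \<chi> i. if i = m then x $ m + x $ n else x $ i"
  let ?L = "\<Pi>\<^sub>M i\<in>(UNIV :: 'n set). (lborel :: real measure)"
  interpret product_sigma_finite "\<lambda>_ :: 'n. lborel :: real measure" by standard
  have "?h \<in> borel_measurable borel"
  proof (intro borel_measurable_continuous_onI continuous_on_vec_lambda)
    show "continuous_on UNIV (\<lambda>x :: real^'n. if i = m then x $ m + x $ n else x $ i)" for i
      by (cases "i = m") (auto intro!: continuous_intros)
  qed
  then have gh [measurable]: "(\<lambda>x. g (?h x)) \<in> borel_measurable borel"
    by simp
  have ins: "insert m (UNIV - {m}) = (UNIV :: 'n set)" by auto
  have split: "(\<integral>\<^sup>+x. f x \<partial>lborel) =
      (\<integral>\<^sup>+\<omega>. \<integral>\<^sup>+y. f (vec_of (fun_upd \<omega> m y)) \<partial>lborel \<partial>(\<Pi>\<^sub>M i\<in>UNIV - {m}. (lborel :: real measure)))"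
    if [measurable]: "f \<in> borel_measurable borel" for f :: "real^'n \<Rightarrow> ennreal"
  proof -
    have "(\<integral>\<^sup>+x. f x \<partial>lborel) = (\<integral>\<^sup>+\<omega>. f (vec_of \<omega>) \<partial>?L)"
      by (subst lborel_vec_of) (simp add: nn_integral_distr)
    also have "\<dots> = (\<integral>\<^sup>+\<omega>. \<integral>\<^sup>+y. f (vec_of (fun_upd \<omega> m y)) \<partial>lborel \<partial>(\<Pi>\<^sub>M i\<in>UNIV - {m}. (lborel :: real measure)))"
      using product_nn_integral_insert[of "UNIV - {m}" m "\<lambda>\<omega>. f (vec_of \<omega>)"] by (simp add: ins)
    finally show ?thesis .
  qed
  have "(\<integral>\<^sup>+y. g (?h (vec_of (fun_upd \<omega> m y))) \<partial>lborel) = (\<integral>\<^sup>+y. g (vec_of (fun_upd \<omega> m y)) \<partial>lborel)" for \<omega>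
  proof -
    have [measurable]: "(\<lambda>y. vec_of (fun_upd \<omega> m y)) \<in> borel_measurable borel"
      by (subst borel_measurable_euclidean_space) (auto simp: vec_of_def Basis_vec_def inner_axis)
    have "?h (vec_of (fun_upd \<omega> m y)) = vec_of (fun_upd \<omega> m (\<omega> n + 1 * y))" for y
      using mn by (simp add: vec_eq_iff vec_of_def)
    then show ?thesis
      using nn_integral_real_affine[of "\<lambda>y. g (vec_of (fun_upd \<omega> m y))" 1 "\<omega> n"] by simp
  qed
  then show ?thesis
    by (simp only: split[OF gh] split[OF g])
qed

text \<open>Linear maps are composed of stretches, swaps, shears and maps with a vanishing coordinate. The claim is an
  implication because the last of these have determinant \<open>0\<close>.\<close>

lemma nn_integral_linear_image:
  fixes f :: "real^'n \<Rightarrow> real^'n"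
  assumes "linear f"
  shows "det (matrix f) \<noteq> 0 \<longrightarrow> (\<forall>g\<in>borel_measurable borel.
    (\<integral>\<^sup>+x. g x \<partial>lborel) = ennreal \<bar>det (matrix f)\<bar> * (\<integral>\<^sup>+x. g (f x) \<partial>lborel))" (is "?P f")
proof (rule induct_linear_elementary[OF assms])
  fix f g :: "real^'n \<Rightarrow> real^'n"
  assume f: "linear f" "?P f" and g: "linear g" "?P g"
  have det: "det (matrix (f \<circ> g)) = det (matrix f) * det (matrix g)"
    by (simp add: matrix_compose[OF g(1) f(1)] det_mul)
  have [measurable]: "f \<in> borel_measurable borel"
    by (intro borel_measurable_continuous_onI linear_continuous_on) (use f(1) linear_conv_bounded_linear in blast)
  show "?P (f \<circ> g)"
  proof (intro impI ballI)
    fix k :: "real^'n \<Rightarrow> ennreal"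
    assume nz: "det (matrix (f \<circ> g)) \<noteq> 0" and k [measurable]: "k \<in> borel_measurable borel"
    have "(\<integral>\<^sup>+x. k x \<partial>lborel) = ennreal \<bar>det (matrix f)\<bar> * (\<integral>\<^sup>+x. k (f x) \<partial>lborel)"
      using nz by (intro f(2)[THEN mp, THEN bspec, OF _ k]) (simp add: det)
    also have "(\<integral>\<^sup>+x. k (f x) \<partial>lborel) = ennreal \<bar>det (matrix g)\<bar> * (\<integral>\<^sup>+x. k (f (g x)) \<partial>lborel)"
      using nz by (intro g(2)[THEN mp, THEN bspec, of "\<lambda>x. k (f x)"]) (simp_all add: det)
    finally show "(\<integral>\<^sup>+x. k x \<partial>lborel) = ennreal \<bar>det (matrix (f \<circ> g))\<bar> * (\<integral>\<^sup>+x. k ((f \<circ> g) x) \<partial>lborel)"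
      by (simp add: det abs_mult ennreal_mult mult.assoc)
  qed
next
  fix f :: "real^'n \<Rightarrow> real^'n" and i
  assume f: "linear f" and zero: "\<And>x. f x $ i = 0"
  have "matrix f $ i $ j = 0" for j
    by (simp add: matrix_def zero)
  then have "det (matrix f) = 0"
    by (intro det_zero_row(1)[of i]) (simp add: row_def vec_eq_iff)
  then show "?P f" by simp
next
  fix c :: "'n \<Rightarrow> real"
  let ?D = "\<lambda>x :: real^'n. \<chi> i. c i * x $ i"
  have det: "det (matrix ?D) = (\<Prod>i\<in>UNIV. c i)"
    by (subst det_diagonal) (auto simp: matrix_def axis_def)
  let ?c = "\<lambda>b :: real^'n. \<Sum>i\<in>UNIV. c i * b $ i"
  have c: "?c (axis i 1) = c i" for i
    by (simp add: axis_def if_distrib cong: if_cong)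
  have D: "?D x = 0 + (\<Sum>b\<in>Basis. (?c b * (x \<bullet> b)) *\<^sub>R b)" for x
  proof -
    have "(\<Sum>b\<in>Basis. (?c b * (x \<bullet> b)) *\<^sub>R b) = (\<Sum>i\<in>UNIV. (c i * x $ i) *\<^sub>R axis i 1)"
      by (subst sum.reindex_bij_betw[of "\<lambda>i. axis i 1" UNIV Basis, symmetric])
        (auto simp: bij_betw_def inj_on_def axis_eq_axis Basis_vec_def c inner_axis)
    also have "\<dots> = ?D x"
      by (simp add: vec_eq_iff axis_def if_distrib cong: if_cong)
    finally show ?thesis by simp
  qed
  show "?P ?D"
  proof (intro impI ballI)
    fix k :: "real^'n \<Rightarrow> ennreal"
    assume nz: "det (matrix ?D) \<noteq> 0" and k [measurable]: "k \<in> borel_measurable borel"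
    have [measurable]: "?D \<in> borel_measurable borel"
      by (rule borel_measurable_continuous_onI) (intro continuous_intros)
    have "lborel = density (distr lborel borel ?D) (\<lambda>_. (\<Prod>b\<in>Basis. \<bar>?c b\<bar>))"
      unfolding D
      by (rule lborel_affine_euclidean) (use nz in \<open>auto simp: det Basis_vec_def c\<close>)
    moreover have "(\<Prod>b\<in>Basis. \<bar>?c b\<bar>) = \<bar>det (matrix ?D)\<bar>"
      unfolding prod_Basis_cart c det by (simp add: abs_prod)
    ultimately have "lborel = density (distr lborel borel ?D) (\<lambda>_. ennreal \<bar>det (matrix ?D)\<bar>)"
      by simp
    then have "(\<integral>\<^sup>+x. k x \<partial>lborel) = (\<integral>\<^sup>+x. k x \<partial>density (distr lborel borel ?D) (\<lambda>_. ennreal \<bar>det (matrix ?D)\<bar>))"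
      by (rule arg_cong)
    also have "\<dots> = ennreal \<bar>det (matrix ?D)\<bar> * (\<integral>\<^sup>+x. k (?D x) \<partial>lborel)"
      by (simp add: nn_integral_density nn_integral_cmult nn_integral_distr)
    finally show "(\<integral>\<^sup>+x. k x \<partial>lborel) = ennreal \<bar>det (matrix ?D)\<bar> * (\<integral>\<^sup>+x. k (?D x) \<partial>lborel)" .
  qed
next
  fix m n :: 'n
  let ?t = "Transposition.transpose m n" and ?h = "\<lambda>x :: real^'n. \<chi> i. x $ Transposition.transpose m n i"
  have "matrix ?h = (\<chi> i. mat 1 $ ?t i)"
    by (auto simp: matrix_def mat_def axis_def vec_eq_iff)
  then have det: "\<bar>det (matrix ?h)\<bar> = 1"
    by (simp add: det_permute_rows[OF permutes_swap_id] abs_mult sign_def)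
  have [measurable]: "?h \<in> borel_measurable borel"
    by (rule borel_measurable_continuous_onI) (intro continuous_intros)
  have "lborel = distr lborel borel ?h"
  proof (rule lborel_eqI)
    fix l u :: "real^'n"
    assume lu: "\<And>b. b \<in> Basis \<Longrightarrow> l \<bullet> b \<le> u \<bullet> b"
    have le: "l $ i \<le> u $ i" for i
      using lu[of "axis i 1"] by (simp add: inner_axis)
    have "?h x \<in> box l u \<longleftrightarrow> x \<in> box (?h l) (?h u)" for x
      unfolding mem_box_cart by simp (metis transpose_involutory)
    then have "?h -` box l u = box (?h l) (?h u)" by auto
    then have "emeasure (distr lborel borel ?h) (box l u) = emeasure lborel (box (?h l) (?h u))"
      by (simp add: emeasure_distr)
    also have "\<dots> = (\<Prod>b\<in>Basis. (?h u - ?h l) \<bullet> b)"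
      by (rule emeasure_lborel_box) (auto simp: Basis_vec_def inner_axis le)
    also have "(\<Prod>b\<in>Basis. (?h u - ?h l) \<bullet> b) = (\<Prod>b\<in>Basis. (u - l) \<bullet> b)"
      unfolding prod_Basis_cart
      using prod.permute[OF permutes_swap_id[of m UNIV n], of "\<lambda>i. u $ i - l $ i"] by (simp add: inner_axis comp_def)
    finally show "emeasure (distr lborel borel ?h) (box l u) = (\<Prod>b\<in>Basis. (u - l) \<bullet> b)" .
  qed simp
  then have "(\<integral>\<^sup>+x. k x \<partial>lborel) = (\<integral>\<^sup>+x. k x \<partial>distr lborel borel ?h)" for k
    by (rule arg_cong)
  then have swap: "(\<integral>\<^sup>+x. k x \<partial>lborel) = (\<integral>\<^sup>+x. k (?h x) \<partial>lborel)"
    if "k \<in> borel_measurable borel" for k :: "real^'n \<Rightarrow> ennreal"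
    using that by (simp only: nn_integral_distr[of ?h lborel borel k, simplified])
  show "?P ?h"
    unfolding det ennreal_1 mult_1 using swap by blast
next
  fix m n :: 'n
  assume mn: "m \<noteq> n"
  let ?h = "\<lambda>x :: real^'n. \<chi> i. if i = m then x $ m + x $ n else x $ i"
  have "matrix ?h = (\<chi> k. if k = m then row m (mat 1) + 1 *s row n (mat 1) else row k (mat 1))"
    by (auto simp: matrix_def mat_def axis_def row_def vec_eq_iff)
  then have "det (matrix ?h) = 1"
    using det_row_operation[OF mn, where A = "mat 1 :: real^'n^'n" and c = 1] by simp
  then show "?P ?h" using nn_integral_shear[OF mn] by simp
qed

lemma lborel_linear_change:
  fixes F :: "real^'n^'n"
  assumes "invertible F"
  shows "lborel = density (distr lborel borel ((*v) F)) (\<lambda>_. ennreal \<bar>det F\<bar>)"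
proof (rule measure_eqI)
  have [measurable]: "(*v) F \<in> borel_measurable borel"
    by (intro borel_measurable_continuous_onI continuous_intros)
  fix A :: "(real^'n) set"
  assume "A \<in> sets lborel"
  then have A [measurable]: "A \<in> sets borel" by simp
  have "emeasure lborel A = (\<integral>\<^sup>+x. indicator A x \<partial>lborel)"
    by simp
  also have "\<dots> = ennreal \<bar>det F\<bar> * (\<integral>\<^sup>+x. indicator A (F *v x) \<partial>lborel)"
    using nn_integral_linear_image[OF matrix_vector_mul_linear, of F, THEN mp, THEN bspec, of "indicator A"] assms
    by (simp only: invertible_det_nz borel_measurable_indicator[OF A] matrix_of_matrix_vector_mul simp_thms)
  also have "(\<integral>\<^sup>+x. indicator A (F *v x) \<partial>lborel) = (\<integral>\<^sup>+x. indicator A x \<partial>distr lborel borel ((*v) F))"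
    by (subst nn_integral_distr) simp_all
  also have "ennreal \<bar>det F\<bar> * \<dots> = emeasure (density (distr lborel borel ((*v) F)) (\<lambda>_. ennreal \<bar>det F\<bar>)) A"
    by (simp add: emeasure_density nn_integral_cmult)
  finally show "emeasure lborel A = emeasure (density (distr lborel borel ((*v) F)) (\<lambda>_. ennreal \<bar>det F\<bar>)) A" .
qed simp

section \<open>The law of a quadratic form in a normal vector\<close>

definition orthonormal_wrt :: "real^'n^'n \<Rightarrow> (real^'n) set \<Rightarrow> bool" where
  "orthonormal_wrt Q B \<longleftrightarrow> (\<forall>a\<in>B. \<forall>b\<in>B. a \<bullet> (Q *v b) = (if a = b then 1 else 0))"

lemma orthonormal_wrt_independent:
  fixes B :: "(real^'n) set"
  assumes "orthonormal_wrt Q B" "finite B"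
  shows "independent B"
proof (rule independent_if_scalars_zero[OF assms(2)])
  fix f :: "real^'n \<Rightarrow> real" and x
  assume f: "(\<Sum>x\<in>B. f x *\<^sub>R x) = 0" and x: "x \<in> B"
  have "0 = (\<Sum>y\<in>B. f y *\<^sub>R y) \<bullet> (Q *v x)" by (simp add: f)
  also have "\<dots> = (\<Sum>y\<in>B. if y = x then f y else 0)"
    using assms(1) x by (auto simp: inner_sum_left orthonormal_wrt_def intro!: sum.cong)
  finally show "f x = 0" using x assms(2) by simp
qed

lemma orthonormal_wrt_residual:
  assumes B: "orthonormal_wrt Q B" "finite B" and "a \<in> B"
  shows "a \<bullet> (Q *v (x - (\<Sum>b\<in>B. (b \<bullet> (Q *v x)) *\<^sub>R b))) = 0"
proof -
  have "a \<bullet> (Q *v (\<Sum>b\<in>B. (b \<bullet> (Q *v x)) *\<^sub>R b)) = (\<Sum>b\<in>B. (b \<bullet> (Q *v x)) * (a \<bullet> (Q *v b)))"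
    by (simp add: linear_sum[OF matrix_vector_mul_linear] inner_sum_right matrix_vector_mult_scaleR)
  also have "\<dots> = (\<Sum>b\<in>B. if b = a then b \<bullet> (Q *v x) else 0)"
    by (intro sum.cong refl) (use B \<open>a \<in> B\<close> in \<open>auto simp: orthonormal_wrt_def\<close>)
  also have "\<dots> = a \<bullet> (Q *v x)" using assms by simp
  finally show ?thesis
    by (simp add: matrix_vector_mult_diff_distrib inner_diff_right)
qed

lemma pos_def_symmetric: "pos_def Q \<Longrightarrow> x \<bullet> (Q *v y) = y \<bullet> (Q *v x)"
  by (metis inner_commute inner_transpose_mv pos_def_def)

text \<open>An orthonormal extension of maximal cardinality spans: otherwise the normalized residual of a vector
  outside its span could be added.\<close>

lemma ex_orthonormal_basis_extending:
  fixes Q :: "real^'n^'n"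
  assumes Q: "pos_def Q" and V: "subspace V" and B0: "finite B0" "B0 \<subseteq> V" "orthonormal_wrt Q B0"
  obtains B where "finite B" "B0 \<subseteq> B" "B \<subseteq> V" "orthonormal_wrt Q B" "span B = V"
proof -
  let ?P = "\<lambda>B. finite B \<and> B0 \<subseteq> B \<and> B \<subseteq> V \<and> orthonormal_wrt Q B"
  have "\<forall>B. ?P B \<longrightarrow> card B < Suc (DIM(real^'n))"
    using independent_bound orthonormal_wrt_independent by (metis less_Suc_eq_le)
  then obtain B where B: "?P B" and max: "\<And>B'. ?P B' \<Longrightarrow> card B' \<le> card B"
    using ex_has_greatest_nat[of ?P B0 card "Suc (DIM(real^'n))"] B0 less_imp_le by blast
  have "V \<subseteq> span B"
  proof (rule ccontr)
    assume "\<not> V \<subseteq> span B"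
    then obtain x where x: "x \<in> V" "x \<notin> span B" by blast
    define y where "y = x - (\<Sum>b\<in>B. (b \<bullet> (Q *v x)) *\<^sub>R b)"
    define w where "w = (1 / sqrt (y \<bullet> (Q *v y))) *\<^sub>R y"
    have "(\<Sum>b\<in>B. (b \<bullet> (Q *v x)) *\<^sub>R b) \<in> span B"
      by (intro span_sum span_scale span_base)
    then have "y \<notin> span B" using x(2) span_add[of y B] unfolding y_def by fastforce
    then have "y \<noteq> 0" using span_zero by metis
    then have pos: "y \<bullet> (Q *v y) > 0" using Q by (simp add: pos_def_def)
    have ww: "w \<bullet> (Q *v w) = 1"
      using pos by (simp add: w_def matrix_vector_mult_scaleR real_sqrt_mult_self)
    have bw: "b \<bullet> (Q *v w) = 0" if "b \<in> B" for b
      using orthonormal_wrt_residual[of Q B b x] B that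
      by (simp add: w_def y_def matrix_vector_mult_scaleR)
    have "w \<notin> B" using bw ww by force
    have "y \<in> V" unfolding y_def
      using B x(1) by (intro subspace_diff[OF V] subspace_sum[OF V] subspace_scale[OF V]) auto
    then have "w \<in> V" unfolding w_def by (rule subspace_scale[OF V])
    moreover have "w \<bullet> (Q *v b) = 0" if "b \<in> B" for b
      using bw[OF that] pos_def_symmetric[OF Q, of w b] by metis
    then have "orthonormal_wrt Q (insert w B)"
      using B ww bw \<open>w \<notin> B\<close> by (auto simp: orthonormal_wrt_def)
    ultimately have "?P (insert w B)" using B by auto
    from max[OF this] show False using B \<open>w \<notin> B\<close> by simp
  qed
  then have "span B = V"
    using B V by (metis span_minimal subset_antisym)
  with B show ?thesis by (intro that) auto
qed

lemma pos_def_invertible: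
  assumes "pos_def Q"
  shows "invertible Q"
proof -
  have "x = 0" if "Q *v x = 0" for x
    using assms that unfolding pos_def_def by (metis inner_zero_right less_irrefl)
  then show ?thesis by (metis invertible_left_inverse matrix_left_invertible_ker)
qed

lemma pos_def_inverse:
  assumes "pos_def Q"
  shows "pos_def (matrix_inv Q)"
proof -
  note inv = matrix_inv_mult[OF pos_def_invertible[OF assms]]
  have "transpose (matrix_inv Q) ** Q = mat 1"
    using inv(1) assms by (metis matrix_transpose_mul pos_def_def transpose_mat)
  then have sym: "transpose (matrix_inv Q) = matrix_inv Q"
    by (metis inv(1) matrix_mul_assoc matrix_mul_lid matrix_mul_rid)
  have "0 < x \<bullet> (matrix_inv Q *v x)" if "x \<noteq> 0" for x
  proof -
    define y where "y = matrix_inv Q *v x"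
    have x: "x = Q *v y" by (simp add: y_def matrix_vector_mul_assoc inv)
    then have "y \<noteq> 0" using that by auto
    then have "0 < y \<bullet> (Q *v y)" using assms by (simp add: pos_def_def)
    also have "y \<bullet> (Q *v y) = x \<bullet> (matrix_inv Q *v x)"
      unfolding x[symmetric] y_def[symmetric] by (rule inner_commute)
    finally show ?thesis .
  qed
  with sym show ?thesis by (simp add: pos_def_def)
qed

lemma pos_def_congruence:
  fixes C :: "real^'n^'k"
  assumes "pos_def Q" and inj: "\<And>x. transpose C *v x = 0 \<Longrightarrow> x = 0"
  shows "pos_def (C ** Q ** transpose C)"
proof -
  have "transpose (C ** Q ** transpose C) = C ** Q ** transpose C"
    using assms(1) by (simp add: matrix_transpose_mul pos_def_def matrix_mul_assoc)
  moreover have "0 < x \<bullet> ((C ** Q ** transpose C) *v x)" if "x \<noteq> 0" for x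
  proof -
    have "x \<bullet> ((C ** Q ** transpose C) *v x) = (transpose C *v x) \<bullet> (Q *v (transpose C *v x))"
      by (simp only: matrix_vector_mul_assoc[symmetric] inner_transpose_mv[of x C])
    then show ?thesis using assms that unfolding pos_def_def by metis
  qed
  ultimately show ?thesis by (simp add: pos_def_def)
qed

subsection \<open>Standardization\<close>

lemma PiM_density_std_normal:
  "(\<Pi>\<^sub>M i\<in>(UNIV :: 'n::finite set). std_normal_distribution) =
     density (\<Pi>\<^sub>M i\<in>UNIV. lborel) (\<lambda>\<omega>. \<Prod>i\<in>UNIV. ennreal (std_normal_density (\<omega> i)))"
proof -
  interpret L: product_sigma_finite "\<lambda>_ :: 'n. lborel :: real measure" by standard
  interpret N: product_sigma_finite "\<lambda>_ :: 'n. std_normal_distribution"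
    using prob_space_normal_density[of 1 0]
    by (auto intro!: product_sigma_finite.intro prob_space_imp_sigma_finite)
  show ?thesis
  proof (rule N.PiM_eqI[symmetric])
    show "sets (density (\<Pi>\<^sub>M i\<in>(UNIV :: 'n set). lborel) (\<lambda>\<omega>. \<Prod>i\<in>UNIV. ennreal (std_normal_density (\<omega> i)))) =
        sets (\<Pi>\<^sub>M i\<in>UNIV. std_normal_distribution)"
      by (simp cong: sets_PiM_cong)
    fix A :: "'n \<Rightarrow> real set"
    assume "\<And>i. i \<in> UNIV \<Longrightarrow> A i \<in> sets std_normal_distribution"
    then have A[measurable]: "\<And>i. A i \<in> sets borel" by simp
    have "emeasure (density (\<Pi>\<^sub>M i\<in>(UNIV :: 'n set). lborel) (\<lambda>\<omega>. \<Prod>i\<in>UNIV. ennreal (std_normal_density (\<omega> i)))) (Pi\<^sub>E UNIV A) =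
        (\<integral>\<^sup>+\<omega>. (\<Prod>i\<in>UNIV. ennreal (std_normal_density (\<omega> i))) * indicator (Pi\<^sub>E UNIV A) \<omega> \<partial>(\<Pi>\<^sub>M i\<in>UNIV. lborel))"
      by (subst emeasure_density) (auto intro!: sets_PiM_I_finite)
    also have "\<dots> = (\<integral>\<^sup>+\<omega>. (\<Prod>i\<in>UNIV. ennreal (std_normal_density (\<omega> i)) * indicator (A i) (\<omega> i)) \<partial>(\<Pi>\<^sub>M i\<in>UNIV. lborel))"
      by (intro nn_integral_cong) (auto simp: prod.distrib PiE_iff indicator_def)
    also have "\<dots> = (\<Prod>i\<in>UNIV. \<integral>\<^sup>+x. ennreal (std_normal_density x) * indicator (A i) x \<partial>lborel)"
      by (subst L.product_nn_integral_prod) auto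
    also have "\<dots> = (\<Prod>i\<in>UNIV. emeasure std_normal_distribution (A i))"
      by (intro prod.cong) (auto simp: emeasure_density)
    finally show "emeasure (density (\<Pi>\<^sub>M i\<in>(UNIV :: 'n set). lborel) (\<lambda>\<omega>. \<Prod>i\<in>UNIV. ennreal (std_normal_density (\<omega> i)))) (Pi\<^sub>E UNIV A) =
        (\<Prod>i\<in>UNIV. emeasure std_normal_distribution (A i))" .
  qed simp
qed

text \<open>An \<open>F\<close> with \<open>F\<^sup>T \<Omega>\<^sup>-\<^sup>1 F = 1\<close> turns the exponent into a sum of squares, and \<open>\<bar>det F\<bar>\<close> is the square root of
  \<open>det \<Omega>\<close>.\<close>

lemma mv_normal_eq_distr:
  fixes \<Omega> F :: "real^'n^'n"
  assumes \<Omega>: "pos_def \<Omega>" and F: "transpose F ** matrix_inv \<Omega> ** F = mat 1"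
  shows "mv_normal \<Omega> = distr (\<Pi>\<^sub>M i\<in>(UNIV :: 'n set). std_normal_distribution) borel (\<lambda>\<omega>. F *v vec_of \<omega>)"
proof -
  let ?L = "\<Pi>\<^sub>M i\<in>(UNIV :: 'n set). (lborel :: real measure)"
  let ?h = "\<lambda>x. ennreal (exp (- (x \<bullet> (matrix_inv \<Omega> *v x)) / 2) / sqrt ((2 * pi) ^ CARD('n) * det \<Omega>))"
  have invF: "invertible F"
    using F by (metis invertible_left_inverse)
  have "det F * det F * det (matrix_inv \<Omega>) = 1"
    using arg_cong[OF F, of det] by (simp add: det_mul det_transpose mult_ac)
  moreover have "det (matrix_inv \<Omega>) * det \<Omega> = 1"
    using arg_cong[OF matrix_inv_mult(2)[OF pos_def_invertible[OF \<Omega>]], of det] by (simp add: det_mul)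
  ultimately have det: "det \<Omega> = (det F)\<^sup>2"
    by (metis mult.assoc mult.commute mult.right_neutral power2_eq_square)
  have dF: "det F \<noteq> 0" using invF invertible_det_nz by blast
  have sqrt_det: "sqrt ((2 * pi) ^ CARD('n) * det \<Omega>) = sqrt (2 * pi) ^ CARD('n) * \<bar>det F\<bar>"
    by (subst det, subst real_sqrt_mult, subst real_sqrt_abs, subst real_sqrt_power) (rule refl)
  have meas_h [measurable]: "?h \<in> borel_measurable borel"
    by (intro measurable_compose[OF borel_measurable_continuous_onI measurable_ennreal] continuous_intros)
      (use det dF in auto)
  have meas_F [measurable]: "(*v) F \<in> borel_measurable borel"
    by (intro borel_measurable_continuous_onI continuous_intros)
  have meas_v [measurable]: "vec_of \<in> ?L \<rightarrow>\<^sub>M borel"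
    by (rule measurable_vec_of_lborel)
  have dens: "ennreal \<bar>det F\<bar> * ?h (F *v vec_of \<omega>) = (\<Prod>i\<in>UNIV. ennreal (std_normal_density (\<omega> i)))" for \<omega>
  proof -
    have "(F *v vec_of \<omega>) \<bullet> (matrix_inv \<Omega> *v (F *v vec_of \<omega>)) = vec_of \<omega> \<bullet> ((transpose F ** matrix_inv \<Omega> ** F) *v vec_of \<omega>)"
      by (simp only: matrix_vector_mul_assoc[symmetric] inner_transpose_mv[of _ "transpose F"] transpose_transpose)
    also have "\<dots> = (\<Sum>i\<in>UNIV. (\<omega> i)\<^sup>2)"
      by (simp add: F inner_vec_def vec_of_def power2_eq_square)
    finally have "\<bar>det F\<bar> * (exp (- ((F *v vec_of \<omega>) \<bullet> (matrix_inv \<Omega> *v (F *v vec_of \<omega>))) / 2) /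
        sqrt ((2 * pi) ^ CARD('n) * det \<Omega>)) = exp (\<Sum>i\<in>UNIV. - (\<omega> i)\<^sup>2 / 2) * (1 / sqrt (2 * pi)) ^ CARD('n)"
      unfolding sqrt_det using dF by (simp add: sum_divide_distrib sum_negf power_one_over)
    also have "\<dots> = (\<Prod>i\<in>UNIV. std_normal_density (\<omega> i))"
      by (simp add: std_normal_density_def exp_sum prod_dividef power_one_over prod.distrib)
    finally have eq: "\<bar>det F\<bar> * (exp (- ((F *v vec_of \<omega>) \<bullet> (matrix_inv \<Omega> *v (F *v vec_of \<omega>))) / 2) /
        sqrt ((2 * pi) ^ CARD('n) * det \<Omega>)) = (\<Prod>i\<in>UNIV. std_normal_density (\<omega> i))" .
    show ?thesis
      by (subst prod_ennreal, simp, subst ennreal_mult'[symmetric], simp, simp only: eq)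
  qed
  have "mv_normal \<Omega> = density (density (distr lborel borel ((*v) F)) (\<lambda>_. ennreal \<bar>det F\<bar>)) ?h"
    unfolding mv_normal_def by (subst lborel_linear_change[OF invF]) (rule refl)
  also have "\<dots> = density (distr lborel borel ((*v) F)) (\<lambda>x. ennreal \<bar>det F\<bar> * ?h x)"
    by (rule density_density_eq) (simp, simp only: measurable_distr_eq1 meas_h)
  also have "distr lborel borel ((*v) F) = distr ?L borel (\<lambda>\<omega>. F *v vec_of \<omega>)"
    by (subst lborel_vec_of) (simp add: distr_distr comp_def)
  also have "density (distr ?L borel (\<lambda>\<omega>. F *v vec_of \<omega>)) (\<lambda>x. ennreal \<bar>det F\<bar> * ?h x) =
      distr (density ?L (\<lambda>\<omega>. ennreal \<bar>det F\<bar> * ?h (F *v vec_of \<omega>))) borel (\<lambda>\<omega>. F *v vec_of \<omega>)"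
    by (rule density_distr) (use meas_h in measurable)
  also have "density ?L (\<lambda>\<omega>. ennreal \<bar>det F\<bar> * ?h (F *v vec_of \<omega>)) = (\<Pi>\<^sub>M i\<in>(UNIV :: 'n set). std_normal_distribution)"
    unfolding dens PiM_density_std_normal ..
  finally show ?thesis .
qed

subsection \<open>Coordinates adapted to the form\<close>

text \<open>The form vanishes on the kernel of \<open>C\<close> and agrees with the squared \<open>\<Omega>\<^sup>-\<^sup>1\<close>-norm on the
  \<open>\<Omega>\<^sup>-\<^sup>1\<close>-orthogonal complement of that kernel, which is the range of \<open>\<Omega> C\<^sup>T\<close>.\<close>

lemma quadratic_form_orthonormal_coordinates:
  fixes \<Omega> :: "real^'n^'n" and C :: "real^'n^'k"
  assumes \<Omega>: "pos_def \<Omega>" and inj: "\<And>x. transpose C *v x = 0 \<Longrightarrow> x = 0"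
  obtains F :: "real^'n^'n" and I :: "'n set" where
    "transpose F ** matrix_inv \<Omega> ** F = mat 1" "card I = CARD('k)"
    "\<And>y. (C *v (F *v y)) \<bullet> (matrix_inv (C ** \<Omega> ** transpose C) *v (C *v (F *v y))) = (\<Sum>i\<in>I. (y $ i)\<^sup>2)"
proof -
  let ?Q = "matrix_inv \<Omega>" and ?S = "C ** \<Omega> ** transpose C"
  let ?g = "\<lambda>w. (\<Omega> ** transpose C) *v w"
  note Q = pos_def_inverse[OF \<Omega>] and inv = matrix_inv_mult[OF pos_def_invertible[OF \<Omega>]]
  note invS = matrix_inv_mult[OF pos_def_invertible[OF pos_def_congruence[OF \<Omega> inj]]]
  have lin: "linear ?g" by simp
  have Qg: "?Q *v ?g w = transpose C *v w" for w
    by (simp only: matrix_vector_mul_assoc matrix_mul_assoc inv matrix_mul_lid)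
  have Cg: "C *v ?g w = ?S *v w" for w
    by (simp only: matrix_vector_mul_assoc matrix_mul_assoc)
  have "inj ?g"
  proof (rule linear_injective_0[OF lin, THEN iffD2], intro allI impI)
    fix w assume "?g w = 0"
    then show "w = 0" using Qg[of w] inj by simp
  qed
  then have dimW: "dim (range ?g) = CARD('k)"
    using dim_image_eq[OF lin, of UNIV] by (simp add: dim_UNIV inj_on_subset)
  have subW: "subspace (range ?g)"
    using linear_subspace_image[OF lin subspace_UNIV] .
  obtain B1 where B1: "finite B1" "B1 \<subseteq> range ?g" "orthonormal_wrt ?Q B1" "span B1 = range ?g"
    using ex_orthonormal_basis_extending[OF Q subW, of "{}"] by (auto simp: orthonormal_wrt_def)
  obtain B where B: "finite B" "B1 \<subseteq> B" "orthonormal_wrt ?Q B" "span B = UNIV"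
    using ex_orthonormal_basis_extending[OF Q subspace_UNIV B1(1) _ B1(3)] by auto
  have cardB1: "card B1 = CARD('k)"
    using dim_span_eq_card_independent[OF orthonormal_wrt_independent[OF B1(3,1)]] B1(4) dimW by simp
  have "card B = CARD('n)"
    using dim_span_eq_card_independent[OF orthonormal_wrt_independent[OF B(3,1)]] B(4) by (simp add: dim_UNIV)
  then obtain b where b: "bij_betw b (UNIV :: 'n set) B"
    using finite_same_card_bij[of "UNIV :: 'n set" B] B(1) by auto
  define F :: "real^'n^'n" where "F = (\<chi> i j. b j $ i)"
  define I where "I = {i. b i \<in> B1}"
  have Fy: "F *v y = (\<Sum>j\<in>UNIV. y $ j *\<^sub>R b j)" for y
    by (simp add: vec_eq_iff F_def matrix_vector_mult_def mult.commute)
  have bb: "b i \<bullet> (?Q *v b j) = (if i = j then 1 else 0)" for i j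
    using b B(3) by (auto simp: orthonormal_wrt_def bij_betw_def inj_def)
  have "(transpose F ** ?Q ** F) $ i $ j = b i \<bullet> (?Q *v b j)" for i j
  proof -
    have "F *v axis j 1 = b j" for j
      by (simp add: vec_eq_iff F_def matrix_vector_mult_basis column_def)
    then have "b i \<bullet> (?Q *v b j) = (F *v axis i 1) \<bullet> (?Q *v (F *v axis j 1))" by simp
    also have "\<dots> = axis i 1 \<bullet> ((transpose F ** ?Q ** F) *v axis j 1)"
      by (simp only: matrix_vector_mul_assoc[symmetric] inner_transpose_mv[of _ "transpose F"] transpose_transpose)
    finally show ?thesis
      by (simp add: matrix_vector_mult_basis column_def inner_axis')
  qed
  then have "transpose F ** ?Q ** F = mat 1"
    by (simp add: vec_eq_iff bb mat_def)
  moreover have "bij_betw b I B1"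
    unfolding I_def using b B(2) by (auto simp: bij_betw_def inj_on_def image_iff)
  then have "card I = CARD('k)"
    using bij_betw_same_card cardB1 by metis
  moreover have "(C *v (F *v y)) \<bullet> (matrix_inv ?S *v (C *v (F *v y))) = (\<Sum>i\<in>I. (y $ i)\<^sup>2)" for y
  proof -
    have kernel: "C *v b i = 0" if "i \<notin> I" for i
    proof -
      have orth: "b i \<bullet> (?Q *v x) = 0" if "x \<in> span B1" for x
        using that
      proof (induction rule: span_induct_alt)
        case (step c a x)
        have "b i \<in> B" "a \<in> B" "b i \<noteq> a"
          using b \<open>i \<notin> I\<close> B(2) step(1) by (auto simp: bij_betw_def I_def)
        then show ?case using B(3) step(2)
          by (simp add: orthonormal_wrt_def matrix_vector_right_distrib matrix_vector_mult_scaleR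
              inner_add_right)
      qed simp
      have "w \<bullet> (C *v b i) = 0" for w
        using orth[of "?g w"] B1(4) Qg[of w]
        by (simp add: inner_transpose_mv[of w C] inner_commute)
      then show ?thesis by (metis inner_eq_zero_iff)
    qed
    define x where "x = (\<Sum>i\<in>I. y $ i *\<^sub>R b i)"
    have "F *v y = x + (\<Sum>i\<in>-I. y $ i *\<^sub>R b i)"
      unfolding Fy x_def by (subst sum.union_disjoint[symmetric]) (auto simp: Compl_partition)
    then have Cx: "C *v (F *v y) = C *v x"
      by (simp add: matrix_vector_right_distrib linear_sum[OF matrix_vector_mul_linear]
          matrix_vector_mult_scaleR kernel)
    have "x \<in> span B1"
      unfolding x_def I_def by (intro span_sum span_scale span_base) auto
    then obtain w where w: "x = ?g w" using B1(4) by auto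
    have "(C *v x) \<bullet> (matrix_inv ?S *v (C *v x)) = (C *v x) \<bullet> w"
      unfolding w Cg by (simp only: matrix_vector_mul_assoc[of "matrix_inv ?S"] invS matrix_vector_mul_lid)
    also have "\<dots> = x \<bullet> (?Q *v x)"
      unfolding w Qg by (simp only: inner_transpose_mv[of _ "transpose C"] transpose_transpose)
    also have "\<dots> = (\<Sum>i\<in>I. (y $ i)\<^sup>2)"
    proof -
      have "x \<bullet> (?Q *v x) = (\<Sum>i\<in>I. \<Sum>j\<in>I. y $ i * (y $ j * (b i \<bullet> (?Q *v b j))))"
        unfolding x_def inner_sum_left
        by (simp add: inner_sum_right linear_sum[OF matrix_vector_mul_linear]
            matrix_vector_mult_scaleR sum_distrib_left) (intro sum.cong refl mult.left_commute)
      also have "\<dots> = (\<Sum>i\<in>I. (y $ i)\<^sup>2)"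
        unfolding bb by (simp add: power2_eq_square if_distrib cong: if_cong)
      finally show ?thesis .
    qed
    finally show ?thesis unfolding Cx .
  qed
  ultimately show ?thesis by (rule that)
qed

lemma measurable_mv_vec_of:
  fixes F :: "real^'n^'m"
  shows "(\<lambda>\<omega>. F *v vec_of \<omega>) \<in> borel_measurable (\<Pi>\<^sub>M i\<in>(UNIV :: 'n set). std_normal_distribution)"
proof -
  have "vec_of \<in> borel_measurable (\<Pi>\<^sub>M i\<in>(UNIV :: 'n set). std_normal_distribution)"
    by (subst measurable_cong_sets[OF sets_PiM_cong[OF refl] refl]) (auto intro: measurable_vec_of)
  then show ?thesis
    by (rule borel_measurable_continuous_on[rotated]) (intro continuous_intros)
qed

lemma distr_quadratic_form_chi_square:
  fixes \<Omega> :: "real^'n^'n" and C :: "real^'n^'k"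
  assumes \<Omega>: "pos_def \<Omega>" and inj: "\<And>x. transpose C *v x = 0 \<Longrightarrow> x = 0"
  shows "distr (mv_normal \<Omega>) borel (\<lambda>x. (C *v x) \<bullet> (matrix_inv (C ** \<Omega> ** transpose C) *v (C *v x))) =
    chi_square CARD('k)"
proof -
  let ?N = "std_normal_distribution"
  obtain F :: "real^'n^'n" and I :: "'n set" where F: "transpose F ** matrix_inv \<Omega> ** F = mat 1"
    and I: "card I = CARD('k)" and form: "\<And>y. (C *v (F *v y)) \<bullet>
      (matrix_inv (C ** \<Omega> ** transpose C) *v (C *v (F *v y))) = (\<Sum>i\<in>I. (y $ i)\<^sup>2)"
    by (rule quadratic_form_orthonormal_coordinates[OF \<Omega> inj]) (assumption, rule that)
  obtain h where h: "bij_betw h {..<CARD('k)} I"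
    using ex_bij_betw_nat_finite[of I] I by (auto simp: lessThan_atLeast0)
  have reindex: "distr (\<Pi>\<^sub>M i\<in>(UNIV :: 'n set). ?N) (\<Pi>\<^sub>M i\<in>{..<CARD('k)}. ?N) (\<lambda>\<omega>. \<lambda>n\<in>{..<CARD('k)}. \<omega> (h n)) =
      (\<Pi>\<^sub>M i\<in>{..<CARD('k)}. ?N)"
    using h by (intro distr_PiM_reindex) (auto simp: bij_betw_def prob_space_normal_density)
  have quad: "(\<lambda>x. (C *v x) \<bullet> (matrix_inv (C ** \<Omega> ** transpose C) *v (C *v x))) \<in> borel_measurable borel"
    by (intro borel_measurable_continuous_onI continuous_intros)
  have "distr (mv_normal \<Omega>) borel (\<lambda>x. (C *v x) \<bullet> (matrix_inv (C ** \<Omega> ** transpose C) *v (C *v x))) =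
      distr (\<Pi>\<^sub>M i\<in>(UNIV :: 'n set). ?N) borel (\<lambda>\<omega>. \<Sum>i\<in>I. (\<omega> i)\<^sup>2)"
    unfolding mv_normal_eq_distr[OF \<Omega> F]
    by (simp only: distr_distr[OF quad measurable_mv_vec_of] comp_def form) (simp add: vec_of_def)
  also have "\<dots> = distr (distr (\<Pi>\<^sub>M i\<in>(UNIV :: 'n set). ?N) (\<Pi>\<^sub>M i\<in>{..<CARD('k)}. ?N)
      (\<lambda>\<omega>. \<lambda>n\<in>{..<CARD('k)}. \<omega> (h n))) borel (\<lambda>x. \<Sum>i<CARD('k). (x i)\<^sup>2)"
    by (subst distr_distr)
      (auto simp: comp_def sum.reindex_bij_betw[OF h, symmetric] intro!: distr_cong)
  also have "\<dots> = chi_square CARD('k)"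
    unfolding reindex chi_square_def ..
  finally show ?thesis .
qed

lemma prob_space_mv_normal:
  fixes \<Omega> :: "real^'n^'n"
  assumes "pos_def \<Omega>"
  shows "prob_space (mv_normal \<Omega>)"
proof -
  let ?N = "\<Pi>\<^sub>M i\<in>(UNIV :: 'n set). std_normal_distribution"
  interpret prob_space ?N
    by (intro prob_space_PiM prob_space_normal_density) simp
  obtain F :: "real^'n^'n" where F: "transpose F ** matrix_inv \<Omega> ** F = mat 1"
    by (rule quadratic_form_orthonormal_coordinates[OF assms, of "mat 1 :: real^'n^'n"]) simp_all
  show ?thesis
    unfolding mv_normal_eq_distr[OF assms F] by (intro prob_space_distr measurable_mv_vec_of)
qed

section \<open>Convergence in distribution\<close>

text \<open>Test against continuous functions that vanish on the ball of radius \<open>K\<close> and are \<open>1\<close> outside that of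
  radius \<open>K + 1\<close>.\<close>

lemma tight_of_conv_in_distr:
  fixes X :: "nat \<Rightarrow> 'w \<Rightarrow> 'b::euclidean_space"
  assumes "prob_space P" "prob_space N" and N: "sets N = sets borel"
    and X: "\<And>T. X T \<in> borel_measurable P" and conv: "conv_in_distr P X N"
  shows "bounded_in_prob P X"
  unfolding bounded_in_prob_def
proof (intro allI impI)
  fix e :: real assume "e > 0"
  interpret P: prob_space P by fact
  interpret N: prob_space N by fact
  define f where "f K x = min 1 (max 0 (norm x - real K))" for K :: nat and x :: 'b
  have f_cont: "continuous_on UNIV (f K)" for K
    unfolding f_def by (intro continuous_intros)
  have f_range: "0 \<le> f K x" "f K x \<le> 1" for K x by (auto simp: f_def)
  have f_bdd: "bounded (range (f K))" for K
    by (rule boundedI[of _ 1]) (use f_range in auto)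
  have f_meas: "f K \<in> borel_measurable borel" for K
    using f_cont by (rule borel_measurable_continuous_onI)
  have f_meas_N: "f K \<in> borel_measurable N" for K
    using f_meas measurable_cong_sets[OF N refl] by blast
  have "(\<lambda>K. \<integral>x. f K x \<partial>N) \<longlonglongrightarrow> (\<integral>x. 0 \<partial>N)"
  proof (rule integral_dominated_convergence[where w = "\<lambda>_. 1"])
    have "(\<lambda>K. f K x) \<longlonglongrightarrow> 0" for x
    proof (rule tendsto_eventually)
      obtain K0 :: nat where "norm x \<le> real K0" using real_arch_simple by blast
      then have "f K x = 0" if "K0 \<le> K" for K
        using that by (simp add: f_def)
      then show "\<forall>\<^sub>F K in sequentially. f K x = 0"
        using eventually_sequentially by blast
    qed
    then show "AE x in N. (\<lambda>K. f K x) \<longlonglongrightarrow> 0" by simp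
  qed (use f_meas_N f_range in auto)
  then have "\<forall>\<^sub>F K in sequentially. (\<integral>x. f K x \<partial>N) < e"
    using \<open>e > 0\<close> by (intro order_tendstoD) auto
  then obtain K where K: "(\<integral>x. f K x \<partial>N) < e"
    using eventually_happens' sequentially_bot by blast
  have "(\<lambda>T. \<integral>\<omega>. f K (X T \<omega>) \<partial>P) \<longlonglongrightarrow> (\<integral>x. f K x \<partial>N)"
    using conv f_cont f_bdd unfolding conv_in_distr_def by blast
  then have "\<forall>\<^sub>F T in sequentially. (\<integral>\<omega>. f K (X T \<omega>) \<partial>P) < e"
    using K by (rule order_tendstoD)
  moreover have "measure P {\<omega> \<in> space P. norm (X T \<omega>) > real K + 1} \<le> (\<integral>\<omega>. f K (X T \<omega>) \<partial>P)" for T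
  proof -
    note [measurable] = X f_meas
    have "measure P {\<omega> \<in> space P. norm (X T \<omega>) > real K + 1} =
        (\<integral>\<omega>. indicator {\<omega> \<in> space P. norm (X T \<omega>) > real K + 1} \<omega> \<partial>P)"
      by simp
    also have "\<dots> \<le> (\<integral>\<omega>. f K (X T \<omega>) \<partial>P)"
    proof (rule integral_mono)
      show "integrable P (\<lambda>\<omega>. f K (X T \<omega>))"
        by (rule P.integrable_const_bound[of _ 1]) (use f_range in auto)
      show "integrable P (indicator {\<omega> \<in> space P. norm (X T \<omega>) > real K + 1} :: _ \<Rightarrow> real)"
        by (rule P.integrable_const_bound[of _ 1]) auto
    qed (auto simp: f_def indicator_def)
    finally show ?thesis .
  qed
  ultimately show "\<exists>K. \<forall>\<^sub>F T in sequentially. measure P {\<omega> \<in> space P. norm (X T \<omega>) > K} < e"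
    by (intro exI[of _ "real K + 1"]) (auto elim!: eventually_mono intro: le_less_trans)
qed

text \<open>Slutsky's theorem for a continuous image. Weak convergence need only be tested on the bounded, uniformly
  continuous functions \<open>cts_step\<close>, which a small perturbation hardly changes.\<close>

lemma weak_conv_of_approximation:
  fixes X :: "nat \<Rightarrow> 'w \<Rightarrow> 'b::euclidean_space" and W :: "nat \<Rightarrow> 'w \<Rightarrow> real" and g :: "'b \<Rightarrow> real"
  assumes P: "prob_space P" and N: "prob_space N" "sets N = sets borel"
    and X [measurable]: "\<And>T. X T \<in> borel_measurable P" and W [measurable]: "\<And>T. W T \<in> borel_measurable P"
    and g: "continuous_on UNIV g" and conv: "conv_in_distr P X N"
    and approx: "\<And>e. e > 0 \<Longrightarrow> (\<lambda>T. measure P {\<omega> \<in> space P. \<bar>W T \<omega> - g (X T \<omega>)\<bar> > e}) \<longlonglongrightarrow> 0"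
  shows "weak_conv_m (\<lambda>T. distr P borel (W T)) (distr N borel g)"
proof -
  interpret P: prob_space P by fact
  interpret N: prob_space N by fact
  have g_meas [measurable]: "g \<in> borel_measurable borel"
    using g by (rule borel_measurable_continuous_onI)
  have g_meas_N: "g \<in> borel_measurable N"
    using g_meas measurable_cong_sets[OF N(2) refl] by blast
  show ?thesis
  proof (rule integral_cts_step_conv_imp_weak_conv)
    show "real_distribution (distr P borel (W T))" for T
      by (rule P.real_distribution_distr) simp
    show "real_distribution (distr N borel g)"
      by (rule N.real_distribution_distr) (rule g_meas_N)
  next
    fix x y :: real assume xy: "x < y"
    let ?s = "cts_step x y"
    have s_unif: "uniformly_continuous_on UNIV ?s"
      using xy by (rule cts_step_uniformly_continuous)
    then have s_cont: "continuous_on UNIV ?s"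
      by (rule uniformly_continuous_imp_continuous)
    then have s_meas [measurable]: "?s \<in> borel_measurable borel"
      by (rule borel_measurable_continuous_onI)
    have s_range: "0 \<le> ?s a" "?s a \<le> 1" for a
      using xy by (auto simp: cts_step_def divide_simps)
    have s_le: "\<bar>?s a\<bar> \<le> 1" for a using s_range[of a] by simp
    have sg: "continuous_on UNIV (\<lambda>v. ?s (g v))"
      by (rule continuous_on_compose2[OF s_cont g]) simp
    moreover have "bounded (range (\<lambda>v. ?s (g v)))"
      by (rule boundedI[of _ 1]) (use s_le in auto)
    ultimately have lim: "(\<lambda>T. \<integral>\<omega>. ?s (g (X T \<omega>)) \<partial>P) \<longlonglongrightarrow> (\<integral>v. ?s (g v) \<partial>N)"
      using conv unfolding conv_in_distr_def by blast
    have int: "integrable P (\<lambda>\<omega>. ?s (W T \<omega>))" "integrable P (\<lambda>\<omega>. ?s (g (X T \<omega>)))" for T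
      by (rule P.integrable_const_bound[of _ 1]; use s_le in simp)+
    have "(\<lambda>T. (\<integral>\<omega>. ?s (W T \<omega>) \<partial>P) - (\<integral>\<omega>. ?s (g (X T \<omega>)) \<partial>P)) \<longlonglongrightarrow> 0"
    proof (rule LIMSEQ_I)
      fix r :: real assume "r > 0"
      then obtain d where d: "d > 0" "\<And>a b. dist b a < d \<Longrightarrow> dist (?s b) (?s a) < r / 2"
        using s_unif[unfolded uniformly_continuous_on_def, rule_format, of "r / 2"] by auto
      let ?A = "\<lambda>T. {\<omega> \<in> space P. \<bar>W T \<omega> - g (X T \<omega>)\<bar> > d / 2}"
      have bound: "\<bar>(\<integral>\<omega>. ?s (W T \<omega>) \<partial>P) - (\<integral>\<omega>. ?s (g (X T \<omega>)) \<partial>P)\<bar> \<le> r / 2 + measure P (?A T)" for T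
      proof -
        have "\<bar>\<integral>\<omega>. ?s (W T \<omega>) - ?s (g (X T \<omega>)) \<partial>P\<bar> \<le> (\<integral>\<omega>. \<bar>?s (W T \<omega>) - ?s (g (X T \<omega>))\<bar> \<partial>P)"
          by (rule integral_abs_bound)
        also have "\<dots> \<le> (\<integral>\<omega>. r / 2 + indicator (?A T) \<omega> \<partial>P)"
        proof (rule integral_mono)
          show "integrable P (\<lambda>\<omega>. \<bar>?s (W T \<omega>) - ?s (g (X T \<omega>))\<bar>)"
            using int by (intro integrable_abs Bochner_Integration.integrable_diff)
          show "integrable P (\<lambda>\<omega>. r / 2 + indicator (?A T) \<omega>)"
            by (intro Bochner_Integration.integrable_add P.integrable_const P.integrable_const_bound[of _ 1]) auto
          fix \<omega> assume "\<omega> \<in> space P"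
          show "\<bar>?s (W T \<omega>) - ?s (g (X T \<omega>))\<bar> \<le> r / 2 + indicator (?A T) \<omega>"
          proof (cases "\<omega> \<in> ?A T")
            case True
            then show ?thesis
              using s_range[of "W T \<omega>"] s_range[of "g (X T \<omega>)"] \<open>r > 0\<close> by simp
          next
            case False
            then have "dist (W T \<omega>) (g (X T \<omega>)) < d"
              using \<open>\<omega> \<in> space P\<close> d(1) by (simp add: dist_real_def)
            from d(2)[OF this] False show ?thesis by (simp add: dist_real_def)
          qed
        qed
        also have "\<dots> = r / 2 + measure P (?A T)"
          by (subst Bochner_Integration.integral_add)
            (auto simp: P.prob_space intro!: P.integrable_const_bound[of _ 1])
        finally show ?thesis by (simp add: int)
      qed
      have "\<forall>\<^sub>F T in sequentially. measure P (?A T) < r / 2"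
        using approx[of "d / 2"] d(1) \<open>r > 0\<close> by (intro order_tendstoD) auto
      then obtain T0 where "\<And>T. T \<ge> T0 \<Longrightarrow> measure P (?A T) < r / 2"
        unfolding eventually_sequentially by blast
      then show "\<exists>T0. \<forall>T\<ge>T0. norm ((\<integral>\<omega>. ?s (W T \<omega>) \<partial>P) - (\<integral>\<omega>. ?s (g (X T \<omega>)) \<partial>P) - 0) < r"
        using bound by (intro exI[of _ T0]) (fastforce intro: le_less_trans)
    qed
    from tendsto_add[OF this lim] show "(\<lambda>T. integral\<^sup>L (distr P borel (W T)) ?s) \<longlonglongrightarrow> integral\<^sup>L (distr N borel g) ?s"
      by (simp add: integral_distr g_meas_N)
  qed
qed

section \<open>Measurability of the statistic\<close>

lemma borel_measurable_mm [measurable]: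
  fixes f :: "'w \<Rightarrow> real^'n^'m" and g :: "'w \<Rightarrow> real^'k^'n"
  assumes "f \<in> borel_measurable M" "g \<in> borel_measurable M"
  shows "(\<lambda>x. f x ** g x) \<in> borel_measurable M"
  using assms by (rule borel_measurable_continuous_Pair) (intro continuous_intros)

lemma borel_measurable_mv [measurable]:
  fixes f :: "'w \<Rightarrow> real^'n^'m" and g :: "'w \<Rightarrow> real^'n"
  assumes "f \<in> borel_measurable M" "g \<in> borel_measurable M"
  shows "(\<lambda>x. f x *v g x) \<in> borel_measurable M"
  using assms by (rule borel_measurable_continuous_Pair) (intro continuous_intros)

lemma borel_measurable_blocks [measurable]:
  "(block_I :: real^('q::finite + 'j::finite)^'p \<Rightarrow> _) \<in> borel_measurable borel"
  "(block_J :: real^('q::finite + 'j::finite)^'p \<Rightarrow> _) \<in> borel_measurable borel"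
  unfolding block_I_def block_J_def
  by (intro borel_measurable_continuous_onI continuous_on_vec_lambda continuous_on_component continuous_on_id)+

lemma borel_measurable_transpose [measurable]: "(transpose :: real^'n^'m \<Rightarrow> _) \<in> borel_measurable borel"
  by (intro borel_measurable_continuous_onI continuous_intros)

lemma borel_measurable_vec_mat [measurable]: "(vec_mat :: real^'n^'m \<Rightarrow> _) \<in> borel_measurable borel"
  by (intro borel_measurable_continuous_onI continuous_intros)

lemma borel_measurable_left_basis [measurable]:
  "(left_basis :: real^('q::finite + 'j::finite)^'p \<Rightarrow> _) \<in> borel_measurable borel"
  unfolding left_basis_def by measurable

lemma borel_measurable_coupling [measurable]:
  fixes R :: "'w \<Rightarrow> real^('q::finite + 'j::finite)^'p"
  assumes [measurable]: "M \<in> borel_measurable P" "R \<in> borel_measurable P"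
  shows "(\<lambda>\<omega>. coupling (M \<omega>) (R \<omega>)) \<in> borel_measurable P"
  unfolding coupling_def Lam_IJ_eq by measurable

lemma borel_measurable_wald_stat [measurable]:
  fixes R :: "'w \<Rightarrow> real^('q::finite + 'j::finite)^'p"
  assumes [measurable]: "R \<in> borel_measurable P" "X \<in> borel_measurable P"
  shows "(\<lambda>\<omega>. wald_stat T U (R \<omega>) (X \<omega>)) \<in> borel_measurable P"
  unfolding wald_stat_def proj_vec_def by measurable

section \<open>The Wald test\<close>

text \<open>Under the null hypothesis \<open>U\<^sup>T\<close> annihilates \<open>R\<^sub>I\<close>, so it keeps its full row rank on \<open>R\<^sub>J\<close>. Each of the
  three factors of the Jacobian then has a right inverse. This is what makes the degrees of freedom
  \<open>q m\<close>, and the limiting covariance matrix regular.\<close>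

lemma wald_jacobian_transpose_injective:
  fixes M :: "real^'p^'p" and R :: "real^('q::finite + 'j::finite)^'p" and U :: "real^'m^'p"
  assumes S: "spectral_split M R" and null: "transpose U ** block_I R = 0" and U: "rank U = CARD('m)"
    and zero: "transpose (wald_jacobian U M R) *v x = 0"
  shows "x = 0"
proof -
  have R: "invertible R" using S by (simp add: spectral_split_def)
  note b = block_products[OF R] and syl = split_invertible_sylvester[OF S]
  have "surj ((*v) (transpose U))"
    using U by (simp add: rank_transpose flip: full_rank_surjective)
  then obtain V0 where V0: "transpose U ** V0 = mat 1"
    using matrix_right_invertible_surjective by blast
  define V where "V = left_J R ** V0"
  have J: "block_J R ** left_J R = mat 1 - block_I R ** left_I R"
    using b(5) by (simp add: eq_diff_eq add.commute)
  have "transpose U ** block_J R ** V = transpose U ** (block_J R ** left_J R) ** V0"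
    by (simp only: V_def matrix_mul_assoc)
  also have "\<dots> = mat 1"
    by (simp add: J mm_distribs matrix_mul_assoc null V0)
  finally have V: "transpose U ** block_J R ** V = mat 1" .
  define K where "K = sylvester (Lam_I M R) (Lam_J M R)"
  define D where "D = kron (transpose (left_I R)) (block_J R) ** K ** kron (mat 1) V"
  have k: "kron (transpose (block_I R)) (left_J R) ** kron (transpose (left_I R)) (block_J R) = mat 1"
  proof -
    have "transpose (block_I R) ** transpose (left_I R) = mat 1"
      by (simp only: matrix_transpose_mul[symmetric] b transpose_mat)
    then show ?thesis by (simp only: kron_mult b kron_mat_1)
  qed
  have "wald_jacobian U M R ** D = kron (mat 1) (transpose U ** block_J R) ** matrix_inv K **
      (kron (transpose (block_I R)) (left_J R) ** kron (transpose (left_I R)) (block_J R)) ** K ** kron (mat 1) V"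
    by (simp only: wald_jacobian_def wald_core_def D_def K_def[symmetric] matrix_mul_assoc)
  also have "\<dots> = kron (mat 1) (transpose U ** block_J R) ** (matrix_inv K ** K) ** kron (mat 1) V"
    by (simp only: k matrix_mul_rid matrix_mul_assoc)
  also have "\<dots> = mat 1"
    using matrix_inv_mult(2)[OF syl[folded K_def]] by (simp add: kron_mult V)
  finally have "transpose D ** transpose (wald_jacobian U M R) = mat 1"
    by (metis matrix_transpose_mul transpose_mat)
  then have "x = transpose D *v (transpose (wald_jacobian U M R) *v x)"
    by (simp add: matrix_vector_mul_assoc)
  then show ?thesis by (simp add: zero)
qed

text \<open>Otherwise there would be sequences that contradict \<open>wald_stat_approximation\<close>.\<close>

lemma wald_stat_uniform_approximation:
  fixes M :: "real^'p^'p" and R :: "real^('q::finite + 'j::finite)^'p" and U :: "real^'m^'p"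
    and \<Omega> :: "real^('p \<times> 'p)^('p \<times> 'p)"
  defines "C \<equiv> wald_jacobian U M R"
  assumes S: "spectral_split M R" and null: "transpose U ** block_I R = 0"
    and inv: "invertible (C ** \<Omega> ** transpose C)" and e: "e > 0"
  obtains T0 \<delta> where "\<delta> > 0" "\<And>T M' \<Omega>' (R' :: real^('q + 'j)^'p) X.
    \<lbrakk>T \<ge> T0; norm (sqrt (real T) *\<^sub>R vec_mat (M' - M)) \<le> K; dist \<Omega>' \<Omega> \<le> \<delta>;
     norm (coupling M' R') \<le> K;
     (\<exists>R'' :: real^('q + 'j)^'p. spectral_split M' R'') \<longrightarrow> spectral_split M' R';
     generalized_inverse (wald_cov U M' R' \<Omega>') X\<rbrakk>
    \<Longrightarrow> \<bar>wald_stat T U R' X - wald_form C \<Omega> (sqrt (real T) *\<^sub>R vec_mat (M' - M))\<bar> \<le> e"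
proof -
  define good where "good T M' \<Omega>' R' X \<delta> \<longleftrightarrow>
     norm (sqrt (real T) *\<^sub>R vec_mat (M' - M)) \<le> K \<and> dist \<Omega>' \<Omega> \<le> \<delta> \<and> norm (coupling M' R') \<le> K \<and>
     ((\<exists>R'' :: real^('q + 'j)^'p. spectral_split M' R'') \<longrightarrow> spectral_split M' R') \<and>
     generalized_inverse (wald_cov U M' R' \<Omega>') X"
    for T :: nat and M' \<Omega>' X \<delta> and R' :: "real^('q + 'j)^'p"
  define err where "err T M' R' X = wald_stat T U R' X - wald_form C \<Omega> (sqrt (real T) *\<^sub>R vec_mat (M' - M))"
    for T M' X and R' :: "real^('q + 'j)^'p"
  have "\<exists>k. \<forall>T\<ge>Suc k. \<forall>M' \<Omega>' R' X. good T M' \<Omega>' R' X (inverse (Suc k)) \<longrightarrow> \<bar>err T M' R' X\<bar> \<le> e"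
  proof (rule ccontr)
    assume "\<not> ?thesis"
    then have "\<forall>k. \<exists>T M' \<Omega>' R' X. T \<ge> Suc k \<and> good T M' \<Omega>' R' X (inverse (Suc k)) \<and> \<not> \<bar>err T M' R' X\<bar> \<le> e"
      by blast
    then obtain T M' \<Omega>' R' X where *: "\<And>k. T k \<ge> Suc k \<and>
        good (T k) (M' k) (\<Omega>' k) (R' k) (X k) (inverse (Suc k)) \<and> \<not> \<bar>err (T k) (M' k) (R' k) (X k)\<bar> \<le> e"
      by metis
    have "(\<lambda>k. M' k - M) \<longlonglongrightarrow> 0"
    proof (rule Lim_null_comparison)
      have "norm (M' k - M) \<le> K * inverse (sqrt (real (Suc k)))" for k
      proof -
        have "sqrt (real (T k)) * norm (M' k - M) \<le> K"
          using *[of k] by (simp add: good_def norm_vec_mat)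
        moreover have "sqrt (real (Suc k)) \<le> sqrt (real (T k))"
          using *[of k] by simp
        ultimately have "sqrt (real (Suc k)) * norm (M' k - M) \<le> K"
          by (meson mult_right_mono norm_ge_zero order_trans)
        then show ?thesis by (simp add: field_simps del: of_nat_Suc)
      qed
      then show "\<forall>\<^sub>F k in sequentially. norm (M' k - M) \<le> K * inverse (sqrt (real (Suc k)))" by simp
      show "(\<lambda>k. K * inverse (sqrt (real (Suc k)))) \<longlonglongrightarrow> 0"
        by real_asymp
    qed
    then have M': "M' \<longlonglongrightarrow> M" by (simp add: LIM_zero_iff)
    have \<Omega>': "\<Omega>' \<longlonglongrightarrow> \<Omega>"
    proof (rule metric_tendsto_imp_tendsto[OF LIMSEQ_inverse_real_of_nat])
      show "\<forall>\<^sub>F k in sequentially. dist (\<Omega>' k) \<Omega> \<le> dist (inverse (real (Suc k))) 0"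
        using * by (simp add: good_def)
    qed
    have "(\<lambda>k. err (T k) (M' k) (R' k) (X k)) \<longlonglongrightarrow> 0"
      unfolding err_def C_def
      by (rule wald_stat_approximation[OF S null inv[unfolded C_def] M' \<Omega>'])
        (use * in \<open>auto simp: good_def\<close>)
    from tendstoD[OF this e] obtain k where "dist (err (T k) (M' k) (R' k) (X k)) 0 < e"
      using eventually_happens' sequentially_bot by blast
    then show False using *[of k] by simp
  qed
  then obtain k where k: "\<And>T M' \<Omega>' R' X. T \<ge> Suc k \<Longrightarrow> good T M' \<Omega>' R' X (inverse (Suc k)) \<Longrightarrow> \<bar>err T M' R' X\<bar> \<le> e"
    by blast
  show ?thesis
    by (rule that[of "inverse (Suc k)" "Suc k"])
      (use k in \<open>auto simp: good_def err_def\<close>)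
qed

theorem theorem1:
  fixes P :: "'w measure"
    and M :: "real^'p^'p"
    and R :: "real^('q::finite + 'j::finite)^'p"
    and G :: "real^'q^'p"
    and U :: "real^'m^'p"
    and \<epsilon> :: "nat \<Rightarrow> 'w \<Rightarrow> real^'p^'p"
    and \<Omega> :: "real^('p \<times> 'p)^('p \<times> 'p)"
    and Mhat :: "nat \<Rightarrow> 'w \<Rightarrow> real^'p^'p"
    and \<Omega>hat :: "nat \<Rightarrow> 'w \<Rightarrow> real^('p \<times> 'p)^('p \<times> 'p)"
    and Rhat :: "nat \<Rightarrow> 'w \<Rightarrow> real^('q + 'j)^'p"
    and \<Omega>Wplus :: "nat \<Rightarrow> 'w \<Rightarrow> real^('p \<times> 'm)^('p \<times> 'm)"
  assumes prob: "prob_space P"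
    and split: "spectral_split M R"
    and G_full_rank: "rank G = CARD('q)"
    and G_normalizing: "rank (transpose G ** block_I R) = CARD('q)"
    and eps_rv: "\<And>t. t \<ge> 1 \<Longrightarrow> \<epsilon> t \<in> borel_measurable P"
    and eps_ident: "\<And>t. t \<ge> 1 \<Longrightarrow> distr P borel (\<epsilon> t) = distr P borel (\<epsilon> 1)"
    and eps_integrable: "\<And>t. t \<ge> 1 \<Longrightarrow> integrable P (\<epsilon> t)"
    and eps_mean: "\<And>t. t \<ge> 1 \<Longrightarrow> (\<integral>\<omega>. \<epsilon> t \<omega> \<partial>P) = 0"
    and eps_sq_integrable: "\<And>t. t \<ge> 1 \<Longrightarrow> integrable P (\<lambda>\<omega>. (norm (\<epsilon> t \<omega>))\<^sup>2)"
    and eps_cov: "\<And>t i k. t \<ge> 1 \<Longrightarrow>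
        (\<integral>\<omega>. vec_mat (\<epsilon> t \<omega>) $ i * vec_mat (\<epsilon> t \<omega>) $ k \<partial>P) = \<Omega> $ i $ k"
    and Omega_pd: "pos_def \<Omega>"
    and Mhat_def: "Mhat = sample_mean (\<lambda>t \<omega>. M + \<epsilon> t \<omega>)"
    and Mhat_clt: "conv_in_distr P (\<lambda>T \<omega>. sqrt (real T) *\<^sub>R vec_mat (Mhat T \<omega> - M)) (mv_normal \<Omega>)"
    and Omegahat_rv: "\<And>T. \<Omega>hat T \<in> borel_measurable P"
    and Omegahat_consistent: "conv_in_prob P \<Omega>hat \<Omega>"
    and Rhat_rv: "\<And>T. Rhat T \<in> borel_measurable P"
    and Rhat_split: "\<And>T. AE \<omega> in P.
        (\<exists>R' :: real^('q + 'j)^'p. spectral_split (Mhat T \<omega>) R') \<longrightarrow>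
          spectral_split (Mhat T \<omega>) (Rhat T \<omega>)"
    and Rhat_complement: "bounded_in_prob P (\<lambda>T \<omega>. coupling (Mhat T \<omega>) (Rhat T \<omega>))"
    and OmegaWplus_rv: "\<And>T. \<Omega>Wplus T \<in> borel_measurable P"
    and OmegaWplus_ginv: "\<And>T. AE \<omega> in P.
        generalized_inverse (wald_cov U (Mhat T \<omega>) (Rhat T \<omega>) (\<Omega>hat T \<omega>)) (\<Omega>Wplus T \<omega>)"
    and U_rank: "rank U = CARD('m)"
    and null: "transpose U ** block_I R ** transpose (block_I (left_basis R)) = 0"
  shows "weak_conv_m
      (\<lambda>T. distr P borel (\<lambda>\<omega>. wald_stat T U (Rhat T \<omega>) (\<Omega>Wplus T \<omega>)))
      (chi_square (CARD('q) * CARD('m)))"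
proof -
  interpret P: prob_space P by (rule prob)
  define C where "C = wald_jacobian U M R"
  define X where "X T \<omega> = sqrt (real T) *\<^sub>R vec_mat (Mhat T \<omega> - M)" for T \<omega>
  define W where "W T \<omega> = wald_stat T U (Rhat T \<omega>) (\<Omega>Wplus T \<omega>)" for T \<omega>
  have R: "invertible R" using split by (simp add: spectral_split_def)
  have U_I: "transpose U ** block_I R = 0"
    using arg_cong[OF null, of "\<lambda>A. A ** block_I R"] block_products(1)[OF R]
    by (simp flip: matrix_mul_assoc)
  have C_inj: "x = 0" if "transpose C *v x = 0" for x
    using wald_jacobian_transpose_injective[OF split U_I U_rank] that unfolding C_def .
  have inv: "invertible (C ** \<Omega> ** transpose C)"
    by (intro pos_def_invertible pos_def_congruence Omega_pd C_inj)
  note [measurable] = Omegahat_rv Rhat_rv OmegaWplus_rv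
  have [measurable]: "Mhat T \<in> borel_measurable P" for T
  proof -
    have "Mhat T = (\<lambda>\<omega>. (1 / real T) *\<^sub>R (\<Sum>t = 1..T. M + \<epsilon> t \<omega>))"
      by (auto simp: Mhat_def sample_mean_def)
    also have "\<dots> \<in> borel_measurable P"
      by (intro borel_measurable_scaleR borel_measurable_sum borel_measurable_add
          borel_measurable_const eps_rv) auto
    finally show ?thesis .
  qed
  have X_rv [measurable]: "X T \<in> borel_measurable P" for T
    unfolding X_def by measurable
  have W_rv [measurable]: "W T \<in> borel_measurable P" for T
    unfolding W_def by measurable
  have N: "prob_space (mv_normal \<Omega>)" "sets (mv_normal \<Omega>) = sets borel"
    using prob_space_mv_normal[OF Omega_pd] by (simp_all add: mv_normal_def)
  have X_conv: "conv_in_distr P X (mv_normal \<Omega>)"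
    using Mhat_clt unfolding X_def .
  have X_tight: "bounded_in_prob P X"
    by (rule tight_of_conv_in_distr[OF prob N X_rv X_conv])
  have "weak_conv_m (\<lambda>T. distr P borel (W T)) (distr (mv_normal \<Omega>) borel (wald_form C \<Omega>))"
  proof (rule weak_conv_of_approximation[OF prob N X_rv W_rv _ X_conv])
    show "continuous_on UNIV (wald_form C \<Omega>)"
      unfolding wald_form_def by (intro continuous_intros)
    fix e :: real assume "e > 0"
    show "(\<lambda>T. measure P {\<omega> \<in> space P. \<bar>W T \<omega> - wald_form C \<Omega> (X T \<omega>)\<bar> > e}) \<longlonglongrightarrow> 0"
    proof (rule order_tendstoI)
      fix r :: real assume "r > 0"
      then have "r / 3 > 0" by simp
      obtain K1 where K1: "\<forall>\<^sub>F T in sequentially. measure P {\<omega> \<in> space P. norm (X T \<omega>) > K1} < r / 3"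
        using X_tight \<open>r / 3 > 0\<close> unfolding bounded_in_prob_def by blast
      obtain K2 where K2: "\<forall>\<^sub>F T in sequentially.
          measure P {\<omega> \<in> space P. norm (coupling (Mhat T \<omega>) (Rhat T \<omega>)) > K2} < r / 3"
        using Rhat_complement \<open>r / 3 > 0\<close> unfolding bounded_in_prob_def by blast
      obtain T0 \<delta> where \<delta>: "\<delta> > 0" and approx: "\<And>T M' \<Omega>' (R' :: real^('q + 'j)^'p) X.
        \<lbrakk>T \<ge> T0; norm (sqrt (real T) *\<^sub>R vec_mat (M' - M)) \<le> max K1 K2; dist \<Omega>' \<Omega> \<le> \<delta>;
         norm (coupling M' R') \<le> max K1 K2;
         (\<exists>R'' :: real^('q + 'j)^'p. spectral_split M' R'') \<longrightarrow> spectral_split M' R';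
         generalized_inverse (wald_cov U M' R' \<Omega>') X\<rbrakk>
        \<Longrightarrow> \<bar>wald_stat T U R' X - wald_form C \<Omega> (sqrt (real T) *\<^sub>R vec_mat (M' - M))\<bar> \<le> e"
        by (rule wald_stat_uniform_approximation[OF split U_I inv[unfolded C_def] \<open>e > 0\<close>, folded C_def])
          blast
      have "(\<lambda>T. measure P {\<omega> \<in> space P. dist (\<Omega>hat T \<omega>) \<Omega> > \<delta>}) \<longlonglongrightarrow> 0"
        using Omegahat_consistent \<delta> unfolding conv_in_prob_def by blast
      then have "\<forall>\<^sub>F T in sequentially. measure P {\<omega> \<in> space P. dist (\<Omega>hat T \<omega>) \<Omega> > \<delta>} < r / 3"
        using \<open>r / 3 > 0\<close> by (rule order_tendstoD)
      with K1 K2 eventually_ge_at_top[of T0]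
      show "\<forall>\<^sub>F T in sequentially. measure P {\<omega> \<in> space P. \<bar>W T \<omega> - wald_form C \<Omega> (X T \<omega>)\<bar> > e} < r"
      proof eventually_elim
        case (elim T)
        \<comment> \<open>Outside these three events, the uniform approximation applies.\<close>
        let ?A1 = "{\<omega> \<in> space P. norm (X T \<omega>) > K1}"
        let ?A2 = "{\<omega> \<in> space P. norm (coupling (Mhat T \<omega>) (Rhat T \<omega>)) > K2}"
        let ?A3 = "{\<omega> \<in> space P. dist (\<Omega>hat T \<omega>) \<Omega> > \<delta>}"
        have "measure P {\<omega> \<in> space P. \<bar>W T \<omega> - wald_form C \<Omega> (X T \<omega>)\<bar> > e} \<le> measure P (?A1 \<union> ?A2 \<union> ?A3)"
        proof (rule P.finite_measure_mono_AE)
          show "AE \<omega> in P. \<omega> \<in> {\<omega> \<in> space P. \<bar>W T \<omega> - wald_form C \<Omega> (X T \<omega>)\<bar> > e} \<longrightarrow> \<omega> \<in> ?A1 \<union> ?A2 \<union> ?A3"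
            using Rhat_split[of T] OmegaWplus_ginv[of T]
          proof eventually_elim
            case (elim \<omega>)
            show ?case
            proof (intro impI, rule ccontr)
              assume bad: "\<omega> \<in> {\<omega> \<in> space P. \<bar>W T \<omega> - wald_form C \<Omega> (X T \<omega>)\<bar> > e}"
                and "\<omega> \<notin> ?A1 \<union> ?A2 \<union> ?A3"
              then have "norm (X T \<omega>) \<le> max K1 K2" "dist (\<Omega>hat T \<omega>) \<Omega> \<le> \<delta>"
                "norm (coupling (Mhat T \<omega>) (Rhat T \<omega>)) \<le> max K1 K2"
                by auto
              from approx[OF \<open>T0 \<le> T\<close> this(1)[unfolded X_def] this(2,3) elim]
              show False using bad by (simp add: W_def X_def)
            qed
          qed
        qed measurable
        also have "\<dots> \<le> measure P (?A1 \<union> ?A2) + measure P ?A3"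
          by (rule measure_Un_le) measurable
        also have "\<dots> \<le> (measure P ?A1 + measure P ?A2) + measure P ?A3"
          by (intro add_right_mono measure_Un_le) measurable
        also have "\<dots> < r" using elim by simp
        finally show ?case .
      qed
    qed (auto intro!: always_eventually less_le_trans[OF _ measure_nonneg])
  qed
  also have "distr (mv_normal \<Omega>) borel (wald_form C \<Omega>) = chi_square (CARD('q) * CARD('m))"
    using distr_quadratic_form_chi_square[OF Omega_pd C_inj] by (simp add: wald_form_def[abs_def])
  finally show ?thesis
    unfolding W_def .
qed

end
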